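(* Let $W$ be a cocompact discrete group generated by reflections acting on the hyperbolic space $X=\mathbb{H}^n\subset V$, let $C\subset V$ be its closed fundamental chamber with interior $C^\circ$, let $C^*$ be the dual cone of $C$ with respect to the Lorentzian form $[\cdot,\cdot]$, and let $\mathcal{K}_-$ be the negative half of the cone $\mathcal{K}=\{x\in V:[x,x]\leqslant 0\}$ (all as in the context). Then: (i) $C^*\setminus\mathcal{K}_-=\bigsqcup_{w\in W}(1-w)C^\circ$; (ii) $\mathcal{K}_-^\circ=\bigsqcup_{w\in W}(-1-w)C^\circ$. Here $\bigsqcup$ means that the set on the left is the union of the indicated sets and that the sets corresponding to distinct $w\in W$ are pairwise disjoint.
   Context: $V=\mathbb{R}^{n+1}$ is Minkowski space with inner product $[x,y]=-x_0y_0+x_1y_1+\ldots+x_ny_n$, and $X=\mathbb{H}^n=\{x\in V:[x,x]=-1,\ x_0>0\}$. A discrete reflection group $W$ is a discrete group of isometries of $X$ generated by reflections in hyperplanes; it acts linearly on $V$ preserving $[\cdot,\cdot]$. It is cocompact, i.e. its fundamental domain $D\subset X$ (the closure of a connected component of the complement in $X$ of the union of all mirrors of reflections in $W$) is compact. The fundamental chamber $C\subset V$ is the closed convex polyhedral cone over $D$ with apex $0$, so that $D=C\cap X$; $C^\circ$ denotes its interior. $C^*=\{y\in V:[y,x]\geqslant 0\text{ for all }x\in C\}$. $\mathcal{K}=\{x\in V:[x,x]\leqslant 0\}=\mathcal{K}_+\cup\mathcal{K}_-$, where $\mathcal{K}_+=\{x\in\mathcal{K}:x_0\geqslant 0\}$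 and $\mathcal{K}_-=\mathcal{K}\setminus\mathcal{K}_+=\{x\in\mathcal{K}:x_0<0\}$; $\mathcal{K}_-^\circ$ is the interior of $\mathcal{K}_-$. For $w\in W$, $(1-w)C^\circ=\{x-wx:x\in C^\circ\}$ and $(-1-w)C^\circ=\{-x-wx:x\in C^\circ\}$. *)

theory Defs
  imports "HOL-Analysis.Analysis" "HOL-Algebra.Generated_Groups"
begin

section \<open>Minkowski space and hyperbolic space\<close>

text \<open>
  A vector \<open>(x\<^sub>0, (x\<^sub>1, \<dots>, x\<^sub>n))\<close> is a pair, with \<open>n = CARD('n)\<close>, so \<open>n \<ge> 1\<close>. The topology
  (interior, closure, compactness) is the Euclidean one.
\<close>

type_synonym 'n minkowski = "real \<times> (real ^ 'n)"

definition mink :: "'n::finite minkowski \<Rightarrow> 'n minkowski \<Rightarrow> real" where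
  "mink x y = - (fst x * fst y) + (\<Sum>i\<in>UNIV. snd x $ i * snd y $ i)"

definition hyperbolic_space :: "'n::finite minkowski set" where
  "hyperbolic_space = {x. mink x x = -1 \<and> fst x > 0}"


section \<open>Reflection groups\<close>

text \<open>
  The isometries of hyperbolic space, in the form in which they act on \<open>V\<close>: every isometry for
  the metric \<open>d(x, y) = arcosh (- [x, y])\<close> is the restriction of exactly one linear map that
  preserves the form and maps hyperbolic space onto itself.
\<close>

definition isometry_group :: "('n::finite minkowski \<Rightarrow>\<^sub>L 'n minkowski) monoid" where
  "isometry_group =
     \<lparr>carrier = {f. (\<forall>x y. mink (blinfun_apply f x) (blinfun_apply f y) = mink x y) \<and>
                   blinfun_apply f ` hyperbolic_space = hyperbolic_space},
      mult = (o\<^sub>L),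
      one = id_blinfun\<rparr>"

text \<open>
  The vectors \<open>a\<close> with \<open>[a, a] > 0\<close> are exactly those whose orthogonal complement meets
  hyperbolic space in a hyperplane.
\<close>

definition hyp_hyperplane :: "'n::finite minkowski \<Rightarrow> 'n minkowski set" where
  "hyp_hyperplane a = {x \<in> hyperbolic_space. mink x a = 0}"

definition reflection_along :: "'n::finite minkowski \<Rightarrow> ('n minkowski \<Rightarrow>\<^sub>L 'n minkowski) \<Rightarrow> bool" where
  "reflection_along a s \<longleftrightarrow>
     mink a a > 0 \<and> (\<forall>x. blinfun_apply s x = x - (2 * mink x a / mink a a) *\<^sub>R a)"

definition mirrors :: "('n::finite minkowski \<Rightarrow>\<^sub>L 'n minkowski) set \<Rightarrow> 'n minkowski set set" where
  "mirrors W = {hyp_hyperplane a | a. \<exists>s\<in>W. reflection_along a s}"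

text \<open>
  Discreteness refers to the operator-norm topology on linear maps, which on isometries
  is the usual (compact-open) topology of the isometry group.
\<close>

definition discrete_reflection_group :: "('n::finite minkowski \<Rightarrow>\<^sub>L 'n minkowski) set \<Rightarrow> bool" where
  "discrete_reflection_group W \<longleftrightarrow>
     discrete W \<and>
     (\<exists>S. (\<forall>s\<in>S. \<exists>a. reflection_along a s) \<and> W = generate isometry_group S)"

text \<open>
  Hyperbolic space is closed in \<open>V\<close>, so closures in it agree with closures in \<open>V\<close>.
\<close>

definition fundamental_domain ::
  "('n::finite minkowski \<Rightarrow>\<^sub>L 'n minkowski) set \<Rightarrow> 'n minkowski set \<Rightarrow> bool" where
  "fundamental_domain W D \<longleftrightarrow>
     (\<exists>U \<in> components (hyperbolic_space - \<Union>(mirrors W)). D = closure U)"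


section \<open>Cones\<close>

definition dual_cone :: "'n::finite minkowski set \<Rightarrow> 'n minkowski set" where
  "dual_cone C = {y. \<forall>x\<in>C. mink y x \<ge> 0}"

definition K_cone :: "'n::finite minkowski set" where
  "K_cone = {x. mink x x \<le> 0}"

definition K_plus :: "'n::finite minkowski set" where
  "K_plus = {x \<in> K_cone. fst x \<ge> 0}"

definition K_minus :: "'n::finite minkowski set" where
  "K_minus = K_cone - K_plus"

end

theory Submission
  imports Defs
begin

text \<open>
  A vector \<open>y\<close> with \<open>[y, y] > 0\<close> has the form \<open>x - w x\<close> exactly when \<open>w x\<close> is the mirror image
  of \<open>x\<close> in \<open>y\<close> and \<open>2 [x, y] = [y, y]\<close>; for timelike \<open>y\<close>, \<open>y = - x - w x\<close> says that \<open>w x\<close> is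
  the point reflection of \<open>x\<close> in \<open>y\<close>. Both parts thus follow from one statement: for every
  isometry \<open>g\<close> of hyperbolic space there are \<open>w \<in> W\<close> and a point \<open>u\<close> in the interior of \<open>D\<close>
  with \<open>g u = w u\<close>, and \<open>w\<close> is unique.

  Such a \<open>u\<close> is an interior fixed point of the composition of \<open>g\<close> with the folding map onto \<open>D\<close>.
  Folding does not increase distances, because \<open>D\<close> is the Dirichlet domain of each of its points,
  and it decreases them strictly for interior points of different chambers; this gives uniqueness.
  Brouwer's theorem gives a fixed point in \<open>D\<close>. To get it off the walls, the map is composed with
  a small push along the normals of the nearby walls: a norm comparison shows that the push
  vanishes at a fixed point of the perturbed map once the perturbation is small enough.
\<close>

section \<open>Minkowski space\<close>

text \<open>The obstacle is the boundary of \<open>D\<close>: Brouwer alone may return a point on a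
  wall, whereas the theorem asks for points of the open chamber. The push is built from inward
  normals, so its pairing with points of \<open>D\<close> is nonnegative; this sign is what makes
  the norm comparison force it to vanish. No second limit is taken: a single sufficiently late
  perturbed fixed point already solves the unperturbed equation exactly. Compactness of
  \<open>D\<close> enters through Brouwer, the finiteness of the set of mirrors touching
  \<open>D\<close>, and a uniform bound on the push. The facts about chambers come from root
  combinatorics. Minimising the distance to a chamber point over words in simple reflections moves
  any point into the chamber, an exchange argument gives freeness, and the two together give the
  Dirichlet property. Chambers are cut out by all positive roots, possibly infinitely many, so
  proper discontinuity is used throughout to reduce to finitely many of them.\<close>

lemma mink_eq_inner: "mink x y = snd x \<bullet> snd y - fst x * fst y"
  unfolding mink_def inner_vec_def by simp

lemma abs_mink_le: "\<bar>mink x y\<bar> \<le> norm x * norm y"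
proof -
  have "mink x y = (- fst x, snd x) \<bullet> y"
    by (simp add: mink_eq_inner inner_prod_def)
  also have "\<bar>\<dots>\<bar> \<le> norm (- fst x, snd x) * norm y"
    by (rule Cauchy_Schwarz_ineq2)
  also have "norm (- fst x, snd x) = norm x"
    by (simp add: norm_prod_def)
  finally show ?thesis .
qed

interpretation mink: bounded_bilinear "mink :: 'n::finite minkowski \<Rightarrow> 'n minkowski \<Rightarrow> real"
proof
  show "\<exists>K. \<forall>a b :: 'n minkowski. norm (mink a b) \<le> norm a * norm b * K"
    by (intro exI[of _ 1]) (simp add: abs_mink_le)
qed (auto simp: mink_eq_inner algebra_simps inner_simps)

lemma mink_commute: "mink x y = mink y x"
  by (simp add: mink_eq_inner inner_commute mult.commute)

lemmas mink_linear = mink.add_left mink.add_right mink.diff_left mink.diff_right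
  mink.minus_left mink.minus_right mink.scaleR_left mink.scaleR_right
  mink.zero_left mink.zero_right

lemma mink_self: "mink x x = (norm (snd x))\<^sup>2 - (fst x)\<^sup>2"
  by (simp add: mink_eq_inner power2_norm_eq_inner) (simp add: power2_eq_square)

lemma mink_nondegenerate:
  assumes "\<And>y. mink x y = 0"
  shows "x = 0"
proof -
  have "mink x (- fst x, snd x) = x \<bullet> x"
    by (simp add: mink_eq_inner inner_prod_def)
  with assms show ?thesis by simp
qed

section \<open>The open future cone and the hyperboloid\<close>

definition future_cone :: "'n::finite minkowski set" where
  "future_cone = {x. mink x x < 0 \<and> fst x > 0}"

lemma open_future_cone: "open future_cone"
  unfolding future_cone_def
  by (intro open_Collect_conj open_Collect_less mink.continuous_on continuous_intros)

lemma future_cone_norm: "x \<in> future_cone \<longleftrightarrow> norm (snd x) < fst x"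
proof -
  have "(norm (snd x))\<^sup>2 < (fst x)\<^sup>2 \<and> fst x > 0 \<longleftrightarrow> norm (snd x) < fst x"
    using power2_less_imp_less[of "norm (snd x)" "fst x"]
      power_strict_mono[of "norm (snd x)" "fst x" 2] norm_ge_zero[of "snd x"] by linarith
  then show ?thesis by (simp add: future_cone_def mink_self)
qed

lemma hyperbolic_future: "x \<in> hyperbolic_space \<Longrightarrow> x \<in> future_cone"
  by (simp add: hyperbolic_space_def future_cone_def)

lemma hyperbolic_mink: "x \<in> hyperbolic_space \<Longrightarrow> mink x x = -1"
  by (simp add: hyperbolic_space_def)

lemma future_cone_scale: "x \<in> future_cone \<Longrightarrow> c > 0 \<Longrightarrow> c *\<^sub>R x \<in> future_cone"
  by (simp add: future_cone_norm)

lemma future_cone_add: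
  assumes "x \<in> future_cone" "y \<in> future_cone" shows "x + y \<in> future_cone"
  using assms norm_triangle_ineq[of "snd x" "snd y"] by (simp add: future_cone_norm)

lemma mink_future_causal:
  assumes x: "x \<in> future_cone" and y: "mink y y \<le> 0" "fst y \<ge> 0" "y \<noteq> 0"
  shows "mink x y < 0"
proof -
  have ny: "norm (snd y) \<le> fst y"
    using y abs_le_square_iff[of "norm (snd y)" "fst y"] by (simp add: mink_self)
  have "fst y \<noteq> 0"
  proof
    assume "fst y = 0"
    with ny have "snd y = 0" by simp
    with \<open>fst y = 0\<close> y(3) show False by (simp add: prod_eq_iff)
  qed
  with y have "fst y > 0" by simp
  have "snd x \<bullet> snd y \<le> norm (snd x) * norm (snd y)" by (rule norm_cauchy_schwarz)
  also have "\<dots> \<le> norm (snd x) * fst y" using ny by (simp add: mult_left_mono)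
  also have "\<dots> < fst x * fst y" using x \<open>fst y > 0\<close> by (simp add: future_cone_norm)
  finally show ?thesis by (simp add: mink_eq_inner)
qed

lemma mink_future: "x \<in> future_cone \<Longrightarrow> y \<in> future_cone \<Longrightarrow> mink x y < 0"
  by (rule mink_future_causal) (auto simp: future_cone_def)

text \<open>A timelike vector lies in one of two opposite cones, and the sign of its product with a
  known future vector decides which. Later this keeps images of points on the upper sheet.\<close>

lemma timelike_future:
  assumes x: "x \<in> future_cone" and y: "mink y y < 0" "mink x y < 0"
  shows "y \<in> future_cone"
proof -
  have "fst y \<noteq> 0" using y(1) by (auto simp: mink_self)
  moreover have "\<not> fst y < 0"
  proof
    assume "fst y < 0"
    then have "- y \<in> future_cone" using y(1) by (simp add: future_cone_def mink_linear)
    from mink_future[OF x this] y(2) show False by (simp add: mink_linear)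
  qed
  ultimately show ?thesis using y(1) by (simp add: future_cone_def)
qed

text \<open>Otherwise both vectors would be at least as long in time as in space, strictly so for x,
  and Cauchy-Schwarz for the spatial parts would rule out orthogonality.\<close>

lemma orthogonal_timelike:
  assumes x: "mink x x < 0" and v: "mink x v = 0" "v \<noteq> 0"
  shows "mink v v > 0"
proof (rule ccontr)
  assume n: "\<not> mink v v > 0"
  then have nv: "norm (snd v) \<le> \<bar>fst v\<bar>"
    using abs_le_square_iff[of "norm (snd v)" "fst v"] by (simp add: mink_self)
  have "fst v \<noteq> 0"
  proof
    assume "fst v = 0"
    with nv have "snd v = 0" by simp
    with \<open>fst v = 0\<close> v(2) show False by (simp add: prod_eq_iff)
  qed
  have nx: "norm (snd x) < \<bar>fst x\<bar>"
    using x abs_le_square_iff[of "fst x" "norm (snd x)"] by (simp add: mink_self)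
  have "\<bar>fst x\<bar> * \<bar>fst v\<bar> = \<bar>snd x \<bullet> snd v\<bar>"
    using v(1) by (simp add: mink_eq_inner abs_mult)
  also have "\<dots> \<le> norm (snd x) * norm (snd v)" by (rule Cauchy_Schwarz_ineq2)
  also have "\<dots> \<le> norm (snd x) * \<bar>fst v\<bar>" using nv by (simp add: mult_left_mono)
  also have "\<dots> < \<bar>fst x\<bar> * \<bar>fst v\<bar>" using nx \<open>fst v \<noteq> 0\<close> by simp
  finally show False by simp
qed

text \<open>The vector \<open>v\<close> is the component of y orthogonal to x, so [v, v] = [x, y]^2
  - 1 is nonnegative and vanishes only for v = 0: the reversed Cauchy-Schwarz inequality with its
  equality case.\<close>

lemma
  assumes "x \<in> hyperbolic_space" "y \<in> hyperbolic_space"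
  shows mink_hyperbolic_le: "mink x y \<le> -1" and mink_hyperbolic_eq: "mink x y = -1 \<Longrightarrow> x = y"
proof -
  define v where "v = y + mink x y *\<^sub>R x"
  have xv: "mink x v = 0" using assms(1) by (simp add: v_def mink_linear hyperbolic_mink)
  have vv: "mink v v = (mink x y)\<^sup>2 - 1"
    using assms by (simp add: hyperbolic_mink v_def mink_linear mink_commute[of y x] power2_eq_square algebra_simps)
  have neg: "mink x y < 0" using assms by (intro mink_future hyperbolic_future)
  have "mink v v \<ge> 0"
    using orthogonal_timelike[OF _ xv] assms(1) by (cases "v = 0") (auto simp: mink_linear hyperbolic_mink)
  then have "\<bar>mink x y\<bar> \<ge> 1" using vv abs_square_less_1[of "mink x y"] by simp
  with neg show "mink x y \<le> -1" by simp
  assume e: "mink x y = -1"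
  then have "mink v v = 0" using vv by simp
  then have "v = 0" using orthogonal_timelike[OF _ xv] assms(1) by (fastforce simp: hyperbolic_mink)
  then show "x = y" using e by (simp add: v_def)
qed

definition normalize_time :: "'n::finite minkowski \<Rightarrow> 'n minkowski" where
  "normalize_time x = (1 / sqrt (- mink x x)) *\<^sub>R x"

lemma normalize_time_hyperbolic:
  assumes "x \<in> future_cone" shows "normalize_time x \<in> hyperbolic_space"
proof -
  define s where "s = sqrt (- mink x x)"
  have s: "s > 0" "s * s = - mink x x" using assms by (simp_all add: s_def future_cone_def)
  have "mink ((1 / s) *\<^sub>R x) ((1 / s) *\<^sub>R x) = mink x x / (s * s)" by (simp add: mink_linear)
  also have "\<dots> = -1" using s assms by (simp add: future_cone_def)
  finally have "mink ((1 / s) *\<^sub>R x) ((1 / s) *\<^sub>R x) = -1" .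
  moreover have "fst ((1 / s) *\<^sub>R x) > 0" using s(1) assms by (simp add: future_cone_def)
  ultimately have "(1 / s) *\<^sub>R x \<in> hyperbolic_space" by (simp only: hyperbolic_space_def mem_Collect_eq simp_thms)
  then show ?thesis by (simp only: normalize_time_def s_def)
qed

lemma future_cone_normalize:
  assumes "x \<in> future_cone"
  obtains t where "t > 0" "normalize_time x \<in> hyperbolic_space" "x = t *\<^sub>R normalize_time x"
proof
  show "sqrt (- mink x x) > 0" using assms by (simp add: future_cone_def)
  then show "x = sqrt (- mink x x) *\<^sub>R normalize_time x" by (simp add: normalize_time_def)
  show "normalize_time x \<in> hyperbolic_space" by (rule normalize_time_hyperbolic[OF assms])
qed

lemma normalize_time_scale:
  assumes "h \<in> hyperbolic_space" "t > 0" shows "normalize_time (t *\<^sub>R h) = h"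
proof -
  have "- mink (t *\<^sub>R h) (t *\<^sub>R h) = t\<^sup>2" using assms(1) by (simp add: mink_linear power2_eq_square hyperbolic_mink)
  then have "sqrt (- mink (t *\<^sub>R h) (t *\<^sub>R h)) = t" using assms(2) by simp
  then show ?thesis using assms(2) by (simp add: normalize_time_def)
qed

lemma continuous_on_normalize_time: "continuous_on future_cone normalize_time"
  unfolding normalize_time_def future_cone_def
  by (intro continuous_on_scaleR continuous_on_divide continuous_on_real_sqrt continuous_on_minus
      mink.continuous_on continuous_on_const continuous_on_id) simp

lemma closed_hyperbolic_space: "closed (hyperbolic_space :: 'n::finite minkowski set)"
proof -
  \<comment> \<open>The strict inequality may be weakened to a closed condition because [x, x] = -1
    excludes x_0 = 0.\<close>
  have "(hyperbolic_space :: 'n minkowski set) = {x. mink x x = -1} \<inter> {x. fst x \<ge> 0}"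
  proof (intro equalityI subsetI)
    fix x :: "'n minkowski" assume "x \<in> {x. mink x x = -1} \<inter> {x. fst x \<ge> 0}"
    then have m: "mink x x = -1" and f: "fst x \<ge> 0" by blast+
    have "fst x \<noteq> 0"
    proof
      assume "fst x = 0"
      then have "mink x x \<ge> 0" by (simp add: mink_self)
      with m show False by linarith
    qed
    with m f show "x \<in> hyperbolic_space" unfolding hyperbolic_space_def mem_Collect_eq by linarith
  qed (auto simp: hyperbolic_space_def)
  moreover have "closed ({x::'n minkowski. mink x x = -1} \<inter> {x. fst x \<ge> 0})"
    by (intro closed_Int closed_Collect_eq closed_Collect_le mink.continuous_on continuous_intros)
  ultimately show ?thesis by simp
qed

lemma norm_square_mink: "(norm x)\<^sup>2 = mink x x + 2 * (fst x)\<^sup>2"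
  by (simp add: mink_self norm_prod_def)

lemma norm_hyperbolic: "x \<in> hyperbolic_space \<Longrightarrow> norm x \<le> 2 * fst x"
proof (rule power2_le_imp_le)
  assume "x \<in> hyperbolic_space"
  then have "(norm x)\<^sup>2 = -1 + 2 * (fst x)\<^sup>2" by (simp add: norm_square_mink hyperbolic_mink)
  then show "(norm x)\<^sup>2 \<le> (2 * fst x)\<^sup>2"
    using zero_le_power2[of "fst x"] four_x_squared[of "fst x"] by linarith
qed (simp add: hyperbolic_space_def)

text \<open>
  The bound \<open>u\<^sub>0 / (2 y\<^sub>0) \<le> - [u, y]\<close> comes from \<open>y\<^sub>0 - \<bar>y'\<bar> = 1 / (y\<^sub>0 + \<bar>y'\<bar>)\<close> on
  the hyperboloid.
\<close>
lemma fst_le_mink: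
  assumes u: "u \<in> hyperbolic_space" and y: "y \<in> hyperbolic_space"
  shows "fst u \<le> 2 * fst y * (- mink u y)"
proof -
  have fu: "norm (snd u) < fst u" and fy: "norm (snd y) < fst y"
    using hyperbolic_future[OF u] hyperbolic_future[OF y] by (auto simp: future_cone_norm)
  have "(fst y + norm (snd y)) * (fst y - norm (snd y)) = 1"
    using hyperbolic_mink[OF y] by (simp add: mink_self algebra_simps power2_eq_square)
  then have "1 \<le> 2 * fst y * (fst y - norm (snd y))"
    using mult_right_mono[of "fst y + norm (snd y)" "2 * fst y" "fst y - norm (snd y)"] fy
    by linarith
  then have "fst u * 1 \<le> fst u * (2 * fst y * (fst y - norm (snd y)))"
    by (rule mult_left_mono) (use fu norm_ge_zero[of "snd u"] in linarith)
  also have "\<dots> = 2 * fst y * (fst u * fst y - fst u * norm (snd y))" by (simp add: algebra_simps)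
  also have "\<dots> \<le> 2 * fst y * (fst u * fst y - snd u \<bullet> snd y)"
  proof (intro mult_left_mono diff_left_mono)
    have "snd u \<bullet> snd y \<le> norm (snd u) * norm (snd y)" by (rule norm_cauchy_schwarz)
    also have "\<dots> \<le> fst u * norm (snd y)" using fu by (intro mult_right_mono) auto
    finally show "snd u \<bullet> snd y \<le> fst u * norm (snd y)" .
    show "0 \<le> 2 * fst y" using fy norm_ge_zero[of "snd y"] by linarith
  qed
  finally show ?thesis by (simp add: mink_eq_inner algebra_simps)
qed

section \<open>Reflections in unit spacelike vectors\<close>

definition reflect :: "'n::finite minkowski \<Rightarrow> 'n minkowski \<Rightarrow> 'n minkowski" where
  "reflect a x = x - (2 * mink x a) *\<^sub>R a"

lemma mink_reflect_self [simp]: "mink a a = 1 \<Longrightarrow> mink (reflect a x) a = - mink x a"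
  by (simp add: reflect_def mink_linear)

lemma reflect_involution [simp]: "mink a a = 1 \<Longrightarrow> reflect a (reflect a x) = x"
  by (simp add: reflect_def mink_linear algebra_simps)

lemma mink_reflect: "mink a a = 1 \<Longrightarrow> mink (reflect a x) (reflect a y) = mink x y"
  by (simp add: reflect_def mink_linear algebra_simps mink_commute[of a y])

lemma mink_reflect_left: "mink (reflect a x) y = mink x (reflect a y)"
  by (simp add: reflect_def mink_linear mink_commute[of a y])

lemma reflect_hyperbolic:
  assumes a: "mink a a = 1" and x: "x \<in> hyperbolic_space"
  shows "reflect a x \<in> hyperbolic_space"
proof -
  have m: "mink (reflect a x) (reflect a x) = -1" using a x by (simp add: mink_reflect hyperbolic_mink)
  have "mink x (reflect a x) = -1 - 2 * (mink x a)\<^sup>2"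
    using x by (simp add: reflect_def mink_linear power2_eq_square hyperbolic_mink)
  then have "mink x (reflect a x) < 0" using zero_le_power2[of "mink x a"] by linarith
  with m have "reflect a x \<in> future_cone" by (intro timelike_future[OF hyperbolic_future[OF x]]) auto
  with m show ?thesis by (simp add: hyperbolic_space_def future_cone_def)
qed

text \<open>Evaluating at b, where the second reflection gives -b, shows that b is parallel to a.
  This later bounds the number of roots belonging to one reflection.\<close>

lemma reflect_eq_unit:
  assumes "mink a a = 1" "mink b b = 1" "\<And>x. reflect a x = reflect b x"
  shows "b = a \<or> b = - a"
proof -
  have "reflect a b = reflect b b" by (rule assms(3))
  then have "2 *\<^sub>R (b - mink b a *\<^sub>R a) = 0"
    using assms(1,2) by (simp add: reflect_def algebra_simps scaleR_2)
  then have e: "b = mink b a *\<^sub>R a" by simp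
  have "mink b b = mink b a * mink b a"
    using arg_cong[OF e, of "\<lambda>v. mink v b"] by (simp add: mink.scaleR_left mink_commute[of a b])
  with assms have "mink b a * mink b a = 1" by simp
  then have "mink b a = 1 \<or> mink b a = -1" by (simp add: square_eq_1_iff)
  then show ?thesis using e by (metis scaleR_one scaleR_minus1_left)
qed

section \<open>Hyperplanes, segments and linear functionals\<close>

lemma generic_point:
  fixes G :: "'n::finite minkowski set"
  assumes "open G" "G \<noteq> {}" "finite A" "0 \<notin> A"
  obtains x where "x \<in> G" "\<And>v. v \<in> A \<Longrightarrow> mink x v \<noteq> 0"
proof -
  have "negligible (\<Union>v\<in>A. {x. mink x v = 0})"
  proof (intro negligible_Union ballI)
    fix T assume "T \<in> (\<lambda>v. {x. mink x v = 0}) ` A"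
    then obtain v where v: "v \<in> A" "T = {x. mink x v = 0}" by blast
    \<comment> \<open>The Euclidean normal of the Lorentzian hyperplane orthogonal to v.\<close>
    have "(- fst v, snd v) \<noteq> 0"
      using v(1) assms(4) by (metis neg_equal_0_iff_equal prod.collapse prod.inject zero_prod_def)
    moreover have "T = {x. (- fst v, snd v) \<bullet> x = 0}"
      unfolding v(2) by (simp add: mink_eq_inner inner_prod_def inner_commute mult.commute)
    ultimately show "negligible T" by (simp add: negligible_hyperplane)
  qed (use assms in simp)
  then have "\<not> G \<subseteq> (\<Union>v\<in>A. {x. mink x v = 0})"
    using open_not_negligible[OF assms(1,2)] negligible_subset by blast
  then show ?thesis using that by blast
qed

text \<open>Linear interpolation. A root that separates two points has a mirror meeting the segment
  between them, which makes local finiteness applicable.\<close>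

lemma segment_zero:
  assumes "mink q a > 0" "mink x a \<le> 0"
  obtains z where "z \<in> closed_segment q x" "mink z a = 0"
proof
  define t where "t = mink q a / (mink q a - mink x a)"
  have d: "mink q a - mink x a > 0" using assms by simp
  have "0 \<le> t" "t \<le> 1" using assms d by (auto simp: t_def divide_le_eq)
  then show "(1 - t) *\<^sub>R q + t *\<^sub>R x \<in> closed_segment q x" by (auto simp: in_segment)
  have "mink ((1 - t) *\<^sub>R q + t *\<^sub>R x) a = mink q a - t * (mink q a - mink x a)"
    by (simp add: mink_linear algebra_simps)
  also have "\<dots> = 0" using d by (simp add: t_def)
  finally show "mink ((1 - t) *\<^sub>R q + t *\<^sub>R x) a = 0" .
qed

text \<open>A linear functional with a maximum inside an open set is zero: test it on small
  multiples of v and -v. This supplies the strictness of the Dirichlet inequality and of positivity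
  on the dual cone.\<close>

lemma mink_open_zero:
  assumes G: "open G" "x \<in> G" and le: "\<And>z. z \<in> G \<Longrightarrow> mink d z \<le> 0" and eq: "mink d x = 0"
  shows "d = 0"
proof -
  obtain e where e: "e > 0" "ball x e \<subseteq> G" using G open_contains_ball by blast
  have half: "mink d v \<le> 0" for v
  proof -
    define t where "t = e / (norm v + 1)"
    have n: "norm v + 1 > 0" by (simp add: add_nonneg_pos)
    then have t: "t > 0" using e by (simp add: t_def)
    have "norm (t *\<^sub>R v) < e" using e n by (simp add: t_def field_simps)
    then have "x + t *\<^sub>R v \<in> ball x e" by (simp add: dist_norm)
    then have "mink d (x + t *\<^sub>R v) \<le> 0" using e le by blast
    then have "t * mink d v \<le> 0" using eq by (simp add: mink_linear)
    with t show ?thesis by (simp add: mult_le_0_iff)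
  qed
  have "mink d v = 0" for v using half[of v] half[of "- v"] by (simp add: mink_linear)
  then show ?thesis by (rule mink_nondegenerate)
qed

lemma convex_future_cone: "convex (future_cone :: 'n::finite minkowski set)"
proof (rule convexI)
  fix x y :: "'n minkowski" and u v :: real
  assume *: "x \<in> future_cone" "y \<in> future_cone" "0 \<le> u" "0 \<le> v" "u + v = 1"
  show "u *\<^sub>R x + v *\<^sub>R y \<in> future_cone"
  proof (cases "u = 0 \<or> v = 0")
    case True
    then show ?thesis using * by auto
  next
    case False
    then show ?thesis using * by (intro future_cone_add future_cone_scale) auto
  qed
qed

section \<open>Discrete groups of Lorentz transformations\<close>

locale lorentz_group =
  fixes W :: "('n::finite minkowski \<Rightarrow>\<^sub>L 'n minkowski) set"
  assumes mink_apply: "w \<in> W \<Longrightarrow> mink (blinfun_apply w x) (blinfun_apply w y) = mink x y"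
    and hyperbolic_apply: "w \<in> W \<Longrightarrow> x \<in> hyperbolic_space \<Longrightarrow> blinfun_apply w x \<in> hyperbolic_space"
    and id_in: "id_blinfun \<in> W"
    and comp_in: "u \<in> W \<Longrightarrow> v \<in> W \<Longrightarrow> u o\<^sub>L v \<in> W"
    and inverse_in: "w \<in> W \<Longrightarrow> \<exists>v\<in>W. v o\<^sub>L w = id_blinfun \<and> w o\<^sub>L v = id_blinfun"
    and discrete_group: "discrete W"
begin

lemma obtain_inverse:
  assumes "w \<in> W"
  obtains v where "v \<in> W" "\<And>x. blinfun_apply v (blinfun_apply w x) = x"
    "\<And>x. blinfun_apply w (blinfun_apply v x) = x"
proof -
  from inverse_in[OF assms] obtain v where
    v: "v \<in> W" "v o\<^sub>L w = id_blinfun" "w o\<^sub>L v = id_blinfun" by blast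
  have "blinfun_apply v (blinfun_apply w x) = x" for x
    using arg_cong[OF v(2), of "\<lambda>f. blinfun_apply f x"] by simp
  moreover have "blinfun_apply w (blinfun_apply v x) = x" for x
    using arg_cong[OF v(3), of "\<lambda>f. blinfun_apply f x"] by simp
  ultimately show ?thesis using that v(1) by blast
qed

lemma future_apply:
  assumes "w \<in> W" "x \<in> future_cone" shows "blinfun_apply w x \<in> future_cone"
proof -
  from future_cone_normalize[OF assms(2)] obtain t where
    t: "t > 0" "normalize_time x \<in> hyperbolic_space" "x = t *\<^sub>R normalize_time x" .
  have "blinfun_apply w x = t *\<^sub>R blinfun_apply w (normalize_time x)"
    using t(3) by (metis blinfun.scaleR_right)
  then show ?thesis
    using t hyperbolic_apply[OF assms(1) t(2)] by (simp add: future_cone_scale hyperbolic_future)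
qed

text \<open>With e_0 = (1, 0), the time coordinate of w x is -[w x, e_0] = -[x, v e_0]. Since w
  preserves the form, \<open>norm_square_mink\<close> turns a bound on this coordinate into one on
  the norm.\<close>

lemma norm_apply_le:
  assumes w: "w \<in> W" and v: "v \<in> W" "\<And>x. blinfun_apply w (blinfun_apply v x) = x"
    and e: "norm (blinfun_apply v (1, 0)) \<le> M"
  shows "norm (blinfun_apply w x) \<le> sqrt (1 + 2 * M\<^sup>2) * norm x"
proof -
  have "fst (blinfun_apply w x) = - mink (blinfun_apply w x) (blinfun_apply w (blinfun_apply v (1, 0)))"
    by (simp add: v(2) mink_eq_inner)
  also have "\<dots> = - mink x (blinfun_apply v (1, 0))" using w by (simp add: mink_apply)
  finally have f: "\<bar>fst (blinfun_apply w x)\<bar> = \<bar>mink x (blinfun_apply v (1, 0))\<bar>" by simp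
  also have "\<dots> \<le> norm x * norm (blinfun_apply v (1, 0))" by (rule abs_mink_le)
  also have "\<dots> \<le> norm x * M" using e by (simp add: mult_left_mono)
  finally have "(fst (blinfun_apply w x))\<^sup>2 \<le> (norm x * M)\<^sup>2" by (rule abs_le_square_iff[THEN iffD1, OF order_trans]) simp
  moreover have "mink x x \<le> (norm x)\<^sup>2" using abs_mink_le[of x x] by (simp add: power2_eq_square)
  ultimately have "(norm (blinfun_apply w x))\<^sup>2 \<le> (1 + 2 * M\<^sup>2) * (norm x)\<^sup>2"
    using w by (simp add: norm_square_mink[of "blinfun_apply w x"] mink_apply power_mult_distrib algebra_simps)
  also have "\<dots> = (sqrt (1 + 2 * M\<^sup>2) * norm x)\<^sup>2" by (simp add: power_mult_distrib)
  finally show ?thesis by (rule power2_le_imp_le) simp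
qed

text \<open>Isolated points alone could still accumulate outside W. Left multiplication by an
  inverse, whose norm is at most K, carries the gap around the identity to every element of the
  ball, so the spacing is uniform and a bounded set of this kind is finite.\<close>

lemma finite_bounded_norm: "finite {w \<in> W. norm w \<le> M}"
proof -
  define K where "K = sqrt (1 + 2 * M\<^sup>2)"
  have K: "K > 0" by (simp add: K_def add_pos_nonneg)
  from discrete_group id_in obtain e where e: "e > 0" "\<And>w. w \<in> W \<Longrightarrow> dist id_blinfun w < e \<Longrightarrow> w = id_blinfun"
    unfolding discrete_def isolated_in_dist_Ex_iff by blast
  have "uniform_discrete {w \<in> W. norm w \<le> M}"
    unfolding uniform_discrete_def
  proof (intro exI[of _ "e / K"] conjI ballI impI)
    fix u v assume u: "u \<in> {w \<in> W. norm w \<le> M}" and v: "v \<in> {w \<in> W. norm w \<le> M}"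
      and d: "dist u v < e / K"
    from inverse_in u obtain u' where
      u': "u' \<in> W" "u' o\<^sub>L u = id_blinfun" "u o\<^sub>L u' = id_blinfun" by blast
    have inv: "blinfun_apply u' (blinfun_apply u x) = x" for x
      using arg_cong[OF u'(2), of "\<lambda>f. blinfun_apply f x"] by simp
    have "norm (blinfun_apply u (1, 0)) \<le> norm u * norm ((1, 0) :: 'n minkowski)"
      by (rule norm_blinfun)
    also have "\<dots> \<le> M" using u by (simp add: norm_prod_def)
    finally have nu': "norm (blinfun_apply u' x) \<le> K * norm x" for x
      unfolding K_def using norm_apply_le[OF u'(1) _ inv] u by simp
    have "norm u' \<le> K" using K nu' by (intro norm_blinfun_bound) auto
    have "(u' o\<^sub>L v) - id_blinfun = u' o\<^sub>L (v - u)"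
      by (rule blinfun_eqI) (simp add: inv blinfun.diff_left blinfun.diff_right)
    then have "dist id_blinfun (u' o\<^sub>L v) = norm (u' o\<^sub>L (v - u))"
      by (metis dist_norm dist_commute)
    also have "\<dots> \<le> norm u' * norm (v - u)" by (rule norm_blinfun_compose)
    also have "\<dots> \<le> K * norm (v - u)" using \<open>norm u' \<le> K\<close> by (simp add: mult_right_mono)
    also have "\<dots> < e" using d K by (simp add: dist_norm norm_minus_commute field_simps)
    finally have "u' o\<^sub>L v = id_blinfun" using e(2) comp_in u'(1) v by simp
    then have "blinfun_apply u' (blinfun_apply v x) = x" for x
      by (metis blinfun_apply_blinfun_compose id_blinfun.rep_eq id_apply)
    then show "u = v"
      using arg_cong[OF u'(3), of "\<lambda>f. blinfun_apply f (blinfun_apply v x)" for x]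
      by (intro blinfun_eqI) (metis blinfun_apply_blinfun_compose id_blinfun.rep_eq id_apply)
  qed (use e K in simp)
  moreover have "bounded {w \<in> W. norm w \<le> M}" by (auto simp: bounded_iff)
  ultimately show ?thesis using uniform_discrete_finite_iff by blast
qed

lemma properly_discontinuous:
  "finite {w \<in> W. \<exists>x\<in>hyperbolic_space. norm x \<le> M \<and> norm (blinfun_apply w x) \<le> M}"
proof (rule finite_subset[OF _ finite_bounded_norm])
  \<comment> \<open>The constant is assembled from three bounds: \<open>fst_le_mink\<close> gives 2
    * M * M for the time coordinate of v e_0, \<open>norm_hyperbolic\<close> doubles it, and
    \<open>norm_apply_le\<close> contributes the square root.\<close>
  show "{w \<in> W. \<exists>x\<in>hyperbolic_space. norm x \<le> M \<and> norm (blinfun_apply w x) \<le> M}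
    \<subseteq> {w \<in> W. norm w \<le> sqrt (1 + 2 * (2 * (2 * M * M))\<^sup>2)}"
  proof clarify
    fix w x assume w: "w \<in> W" and x: "x \<in> hyperbolic_space" "norm x \<le> M" "norm (blinfun_apply w x) \<le> M"
    from obtain_inverse[OF w] obtain v where v: "v \<in> W"
      "\<And>x. blinfun_apply v (blinfun_apply w x) = x" "\<And>x. blinfun_apply w (blinfun_apply v x) = x"
      by blast
    have e0: "(1, 0) \<in> hyperbolic_space" by (simp add: hyperbolic_space_def mink_eq_inner)
    have h: "blinfun_apply v (1, 0) \<in> hyperbolic_space" using hyperbolic_apply[OF v(1) e0] .
    have "fst y \<le> norm y" for y :: "'n minkowski"
      using norm_fst_le[of "fst y" "snd y"] by simp
    then have f: "fst x \<le> M" "fst (blinfun_apply w x) \<le> M" using x order_trans by blast+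
    have fp: "fst x > 0" "fst (blinfun_apply w x) > 0"
      using x(1) hyperbolic_apply[OF w x(1)] by (auto simp: hyperbolic_space_def)
    have "mink (blinfun_apply v (1, 0)) x = mink (1, 0) (blinfun_apply w x)"
      using mink_apply[OF w, of "blinfun_apply v (1, 0)" x] v(3) by simp
    then have "fst (blinfun_apply v (1, 0)) \<le> 2 * fst x * fst (blinfun_apply w x)"
      using fst_le_mink[OF h x(1)] by (simp add: mink_eq_inner)
    also have "\<dots> \<le> 2 * M * M" using f fp by (intro mult_mono) auto
    finally have "norm (blinfun_apply v (1, 0)) \<le> 2 * (2 * M * M)" using norm_hyperbolic[OF h] by simp
    from norm_apply_le[OF w v(1) v(3) this]
    show "norm w \<le> sqrt (1 + 2 * (2 * (2 * M * M))\<^sup>2)" by (intro norm_blinfun_bound) auto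
  qed
qed

text \<open>Convergence of x and of its images confines the w k to a finite set, and an element that
  does not send x0 to y0 can occur only finitely often. This lets the fixed-point argument pass to
  the limit although the group elements vary.\<close>

lemma eventually_apply_limit:
  assumes w: "\<And>k. w k \<in> W" and x: "\<And>k. x k \<in> hyperbolic_space"
    and lx: "x \<longlonglongrightarrow> x0" and ly: "(\<lambda>k. blinfun_apply (w k) (x k)) \<longlonglongrightarrow> y0"
  shows "eventually (\<lambda>k. blinfun_apply (w k) x0 = y0) sequentially"
proof -
  from convergent_imp_bounded[OF lx] obtain M1 where M1: "\<And>k. norm (x k) \<le> M1"
    by (auto simp: bounded_iff)
  from convergent_imp_bounded[OF ly] obtain M2 where M2: "\<And>k. norm (blinfun_apply (w k) (x k)) \<le> M2"
    by (auto simp: bounded_iff)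
  define F where "F = {w \<in> W. \<exists>x\<in>hyperbolic_space. norm x \<le> max M1 M2 \<and> norm (blinfun_apply w x) \<le> max M1 M2}"
  have F: "finite F" unfolding F_def by (rule properly_discontinuous)
  have wF: "w k \<in> F" for k
    unfolding F_def using w x M1 M2 by (force intro: order_trans[OF _ max.cobounded1] order_trans[OF _ max.cobounded2])
  have "eventually (\<lambda>k. w k = u \<longrightarrow> blinfun_apply u x0 = y0) sequentially" for u
  proof (cases "blinfun_apply u x0 = y0")
    case False
    have "(\<lambda>k. blinfun_apply u (x k) - blinfun_apply (w k) (x k)) \<longlonglongrightarrow> blinfun_apply u x0 - y0"
      by (intro tendsto_diff ly blinfun.tendsto tendsto_const lx)
    then have "eventually (\<lambda>k. blinfun_apply u (x k) - blinfun_apply (w k) (x k) \<noteq> 0) sequentially"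
      using False by (intro tendsto_imp_eventually_ne) auto
    then show ?thesis by (rule eventually_mono) auto
  qed simp
  then have "eventually (\<lambda>k. \<forall>u\<in>F. w k = u \<longrightarrow> blinfun_apply u x0 = y0) sequentially"
    by (intro eventually_ball_finite[OF F]) blast
  then show ?thesis by (rule eventually_mono) (use wF in blast)
qed

section \<open>Roots and local finiteness of the mirrors\<close>

definition roots :: "'n minkowski set" where
  "roots = {a. mink a a = 1 \<and> (\<exists>s\<in>W. \<forall>x. blinfun_apply s x = reflect a x)}"

lemma root_unit: "a \<in> roots \<Longrightarrow> mink a a = 1"
  by (simp add: roots_def)

lemma root_reflection:
  assumes "a \<in> roots" obtains s where "s \<in> W" "\<And>x. blinfun_apply s x = reflect a x"
  using assms by (auto simp: roots_def)

lemma root_uminus: "a \<in> roots \<Longrightarrow> - a \<in> roots"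
  by (simp add: roots_def reflect_def mink_linear)

text \<open>Conjugating the reflection in a by w gives the reflection in w a.\<close>

lemma root_apply:
  assumes w: "w \<in> W" and a: "a \<in> roots" shows "blinfun_apply w a \<in> roots"
proof -
  from obtain_inverse[OF w] obtain v where v: "v \<in> W"
    "\<And>x. blinfun_apply v (blinfun_apply w x) = x" "\<And>x. blinfun_apply w (blinfun_apply v x) = x"
    by blast
  from root_reflection[OF a] obtain s where s: "s \<in> W" "\<And>x. blinfun_apply s x = reflect a x" by blast
  have "w o\<^sub>L (s o\<^sub>L v) \<in> W" using w s(1) v(1) by (intro comp_in)
  moreover have "blinfun_apply (w o\<^sub>L (s o\<^sub>L v)) x = reflect (blinfun_apply w a) x" for x
    using mink_apply[OF w, of "blinfun_apply v x" a]
    by (simp add: s(2) reflect_def v(3) blinfun.diff_right blinfun.scaleR_right)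
  moreover have "mink (blinfun_apply w a) (blinfun_apply w a) = 1"
    using mink_apply[OF w, of a a] root_unit[OF a] by simp
  ultimately show ?thesis unfolding roots_def by blast
qed

lemma root_reflect: "a \<in> roots \<Longrightarrow> b \<in> roots \<Longrightarrow> reflect a b \<in> roots"
  by (metis root_reflection root_apply)

text \<open>A reflection fixes the points of its mirror, so proper discontinuity leaves finitely
  many reflections, each with at most two unit normals.\<close>

lemma finite_roots_bounded:
  "finite {a \<in> roots. \<exists>x\<in>hyperbolic_space. norm x \<le> M \<and> mink x a = 0}"
proof -
  define F where "F = {w \<in> W. \<exists>x\<in>hyperbolic_space. norm x \<le> M \<and> norm (blinfun_apply w x) \<le> M}"
  define R where "R s = {a. mink a a = 1 \<and> (\<forall>x. blinfun_apply s x = reflect a x)}" for s :: "'n minkowski \<Rightarrow>\<^sub>L 'n minkowski"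
  have "finite (R s)" for s
  proof (cases "R s = {}")
    case False
    then obtain a where a: "a \<in> R s" by blast
    have "R s \<subseteq> {a, - a}"
    proof
      fix b assume "b \<in> R s"
      with a have "b = a \<or> b = - a" by (intro reflect_eq_unit) (auto simp: R_def)
      then show "b \<in> {a, - a}" by blast
    qed
    then show ?thesis by (rule finite_subset) simp
  qed simp
  moreover have "finite F" unfolding F_def by (rule properly_discontinuous)
  ultimately have "finite (\<Union>s\<in>F. R s)" by blast
  moreover have "{a \<in> roots. \<exists>x\<in>hyperbolic_space. norm x \<le> M \<and> mink x a = 0} \<subseteq> (\<Union>s\<in>F. R s)"
  proof
    fix a assume "a \<in> {a \<in> roots. \<exists>x\<in>hyperbolic_space. norm x \<le> M \<and> mink x a = 0}"
    then obtain x where a: "a \<in> roots" and x: "x \<in> hyperbolic_space" "norm x \<le> M" "mink x a = 0" by blast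
    from root_reflection[OF a] obtain s where s: "s \<in> W" "\<And>x. blinfun_apply s x = reflect a x" by blast
    have "blinfun_apply s x = x" using x(3) by (simp add: s(2) reflect_def)
    then have "s \<in> F" using s(1) x by (auto simp: F_def)
    then show "a \<in> (\<Union>s\<in>F. R s)" using s(2) root_unit[OF a] by (auto simp: R_def)
  qed
  ultimately show ?thesis by (rule finite_subset[rotated])
qed

text \<open>Mirrors are linear, so K may be projected radially to the hyperboloid, where its image
  is bounded.\<close>

lemma locally_finite_roots:
  assumes K: "compact K" "K \<subseteq> future_cone"
  shows "finite {a \<in> roots. \<exists>x\<in>K. mink x a = 0}"
proof -
  have "compact (normalize_time ` K)"
    using K continuous_on_normalize_time continuous_on_subset compact_continuous_image by blast
  then obtain M where M: "\<And>x. x \<in> K \<Longrightarrow> norm (normalize_time x) \<le> M"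
    using compact_imp_bounded by (fastforce simp: bounded_iff)
  have "{a \<in> roots. \<exists>x\<in>K. mink x a = 0}
    \<subseteq> {a \<in> roots. \<exists>x\<in>hyperbolic_space. norm x \<le> M \<and> mink x a = 0}"
  proof clarify
    fix a x assume x: "x \<in> K" "mink x a = 0"
    have "normalize_time x \<in> hyperbolic_space" using x K by (blast intro: normalize_time_hyperbolic)
    moreover have "mink (normalize_time x) a = 0" using x by (simp add: normalize_time_def mink_linear)
    ultimately show "\<exists>x\<in>hyperbolic_space. norm x \<le> M \<and> mink x a = 0" using M[OF x(1)] by blast
  qed
  then show ?thesis by (rule finite_subset[OF _ finite_roots_bounded])
qed

end

section \<open>Chambers of a reflection group\<close>

text \<open>Keeping the list of letters, and not just the group element, allows induction on length
  and restriction to simple letters. The head is applied last.\<close>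

primrec word :: "'n::finite minkowski list \<Rightarrow> 'n minkowski \<Rightarrow> 'n minkowski" where
  "word [] x = x"
| "word (a # as) x = reflect a (word as x)"

lemma word_append: "word (as @ bs) x = word as (word bs x)"
  by (induction as) auto

lemma word_rev: "(\<And>a. a \<in> set as \<Longrightarrow> mink a a = 1) \<Longrightarrow> word (rev as) (word as x) = x"
  by (induction as arbitrary: x) (auto simp: word_append)

locale reflection_group = lorentz_group W for W :: "('n::finite minkowski \<Rightarrow>\<^sub>L 'n minkowski) set" +
  assumes generated: "w \<in> W \<Longrightarrow> \<exists>as. set as \<subseteq> roots \<and> (\<forall>x. blinfun_apply w x = word as x)"
begin

lemma word_in_group:
  assumes "set as \<subseteq> roots"
  obtains w where "w \<in> W" "\<And>x. blinfun_apply w x = word as x"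
proof -
  from assms have "\<exists>w\<in>W. \<forall>x. blinfun_apply w x = word as x"
  proof (induction as)
    case Nil
    then show ?case using id_in by force
  next
    case (Cons a as)
    then obtain w where w: "w \<in> W" "\<And>x. blinfun_apply w x = word as x" by auto
    from Cons have "a \<in> roots" by simp
    then obtain s where s: "s \<in> W" "\<And>x. blinfun_apply s x = reflect a x"
      by (rule root_reflection) blast
    have "s o\<^sub>L w \<in> W" using s w by (intro comp_in)
    moreover have "blinfun_apply (s o\<^sub>L w) x = word (a # as) x" for x by (simp add: s w)
    ultimately show ?case by blast
  qed
  with that show ?thesis by blast
qed

end

locale chamber = reflection_group W for W :: "('n::finite minkowski \<Rightarrow>\<^sub>L 'n minkowski) set" +
  fixes p :: "'n minkowski"
  assumes base: "p \<in> hyperbolic_space" and base_regular: "a \<in> roots \<Longrightarrow> mink p a \<noteq> 0"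
begin

definition pos where "pos = {a \<in> roots. mink p a > 0}"

definition open_chamber where "open_chamber = {x \<in> future_cone. \<forall>a\<in>pos. mink x a > 0}"

definition closed_chamber where "closed_chamber = {x \<in> future_cone. \<forall>a\<in>pos. mink x a \<ge> 0}"

text \<open>The classical property of simple reflections, that they permute the other positive
  roots, serves as the definition; it is exactly what the exchange argument uses.\<close>

definition simple where "simple = {b \<in> pos. \<forall>a\<in>pos. a \<noteq> b \<longrightarrow> reflect b a \<in> pos}"

lemma pos_root: "a \<in> pos \<Longrightarrow> a \<in> roots"
  by (simp add: pos_def)

lemma simple_root: "simple \<subseteq> roots"
  by (auto simp: simple_def pos_def)

lemma root_cases: "a \<in> roots \<Longrightarrow> a \<in> pos \<or> - a \<in> pos"
  using base_regular[of a] root_uminus[of a] by (auto simp: pos_def mink_linear)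

lemma base_open_chamber: "p \<in> open_chamber"
  using base by (simp add: open_chamber_def pos_def hyperbolic_future)

lemma open_subset_closed: "open_chamber \<subseteq> closed_chamber"
  by (auto simp: open_chamber_def closed_chamber_def less_imp_le)

lemma chamber_future: "x \<in> closed_chamber \<Longrightarrow> x \<in> future_cone" "x \<in> open_chamber \<Longrightarrow> x \<in> future_cone"
  by (auto simp: open_chamber_def closed_chamber_def)

lemma root_open_chamber_ne: "x \<in> open_chamber \<Longrightarrow> a \<in> roots \<Longrightarrow> mink x a \<noteq> 0"
  using root_cases[of a] by (fastforce simp: open_chamber_def mink_linear)

lemma root_pos_if: "x \<in> closed_chamber \<Longrightarrow> a \<in> roots \<Longrightarrow> mink x a > 0 \<Longrightarrow> a \<in> pos"
  using root_cases[of a] by (fastforce simp: closed_chamber_def mink_linear)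

lemma open_chamber_scale: "x \<in> open_chamber \<Longrightarrow> t > 0 \<Longrightarrow> t *\<^sub>R x \<in> open_chamber"
  by (simp add: open_chamber_def future_cone_scale mink_linear)

lemma closed_chamber_scale: "x \<in> closed_chamber \<Longrightarrow> t > 0 \<Longrightarrow> t *\<^sub>R x \<in> closed_chamber"
  by (simp add: closed_chamber_def future_cone_scale mink_linear)

lemma chamber_normalize:
  "x \<in> open_chamber \<Longrightarrow> normalize_time x \<in> open_chamber"
  "x \<in> closed_chamber \<Longrightarrow> normalize_time x \<in> closed_chamber"
  unfolding normalize_time_def
  using chamber_future[of x]
  by (auto intro!: open_chamber_scale closed_chamber_scale simp: future_cone_def)

lemma closed_open_add: "x \<in> closed_chamber \<Longrightarrow> y \<in> open_chamber \<Longrightarrow> x + y \<in> open_chamber"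
  by (auto simp: closed_chamber_def open_chamber_def future_cone_add mink_linear add_nonneg_pos)

text \<open>Only the finitely many roots in F have mirrors meeting a small ball around q. Every
  other positive root keeps its sign on the ball, as a sign change would put a zero on a segment
  inside it.\<close>

lemma open_open_chamber: "open open_chamber"
  unfolding open_contains_ball
proof
  fix q assume q: "q \<in> open_chamber"
  then obtain e where e: "e > 0" "cball q e \<subseteq> future_cone"
    using open_future_cone open_contains_cball chamber_future by blast
  define F where "F = {a \<in> roots. \<exists>x\<in>cball q e. mink x a = 0} \<inter> pos"
  have "finite {a \<in> roots. \<exists>x\<in>cball q e. mink x a = 0}" using e by (intro locally_finite_roots) auto
  then have F: "finite F" by (simp add: F_def)
  define G where "G = ball q e \<inter> (\<Inter>a\<in>F. {x. mink x a > 0})"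
  have "open G" unfolding G_def
    using F by (intro open_Int open_ball open_INT ballI open_Collect_less mink.continuous_on continuous_intros)
  moreover have "q \<in> G" using q e by (auto simp: G_def F_def open_chamber_def)
  moreover have "G \<subseteq> open_chamber"
  proof
    fix x assume x: "x \<in> G"
    then have xb: "x \<in> cball q e" by (auto simp: G_def)
    have "mink x a > 0" if a: "a \<in> pos" for a
    proof (rule ccontr)
      assume "\<not> mink x a > 0"
      moreover have "mink q a > 0" using q a by (simp add: open_chamber_def)
      ultimately obtain z where z: "z \<in> closed_segment q x" "mink z a = 0"
        using segment_zero[of q a x] by auto
      have "closed_segment q x \<subseteq> cball q e"
        using xb e by (intro closed_segment_subset) auto
      then have "a \<in> F" using z a by (auto simp: F_def pos_root)
      with x \<open>\<not> mink x a > 0\<close> show False by (auto simp: G_def)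
    qed
    then show "x \<in> open_chamber" using xb e by (auto simp: open_chamber_def)
  qed
  ultimately show "\<exists>e>0. ball q e \<subseteq> open_chamber" by (meson open_contains_ball subset_trans)
qed

section \<open>Simple roots as first crossed mirrors, and words in simple reflections\<close>

lemma exists_simple_negative:
  assumes z: "z \<in> future_cone" "z \<notin> closed_chamber"
  obtains b where "b \<in> simple" "mink z b < 0"
proof -
  define N where "N = {a \<in> pos. mink z a < 0}"
  have "N \<noteq> {}" using z by (auto simp: N_def closed_chamber_def not_le)
  have "closed_segment p z \<subseteq> future_cone"
    using z hyperbolic_future[OF base] by (intro closed_segment_subset convex_future_cone)
  then have "finite {a \<in> roots. \<exists>x\<in>closed_segment p z. mink x a = 0}"
    by (intro locally_finite_roots) auto
  moreover have "N \<subseteq> {a \<in> roots. \<exists>x\<in>closed_segment p z. mink x a = 0}"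
  proof
    fix a assume a: "a \<in> N"
    then have "mink p a > 0" "mink z a \<le> 0" by (auto simp: N_def pos_def)
    then obtain x where "x \<in> closed_segment p z" "mink x a = 0" by (rule segment_zero)
    with a show "a \<in> {a \<in> roots. \<exists>x\<in>closed_segment p z. mink x a = 0}" by (auto simp: N_def pos_def)
  qed
  ultimately have "finite N" by (rule finite_subset[rotated])
  \<comment> \<open>The product of q with such a vector vanishes exactly when the mirrors of a and b
    are crossed at the same parameter; avoiding these zeros rules out ties.\<close>
  define A where "A = (\<Union>a\<in>N. \<Union>b\<in>N - {a}. {mink z b *\<^sub>R a - mink z a *\<^sub>R b})"
  have "0 \<notin> A"
  proof
    assume "0 \<in> A"
    then obtain a b where ab: "a \<in> N" "b \<in> N" "a \<noteq> b" "0 = mink z b *\<^sub>R a - mink z a *\<^sub>R b"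
      unfolding A_def by blast
    from ab(4)[symmetric] have eq: "mink z b *\<^sub>R a = mink z a *\<^sub>R b" by (rule right_minus_eq[THEN iffD1])
    have neg: "mink z a < 0" "mink z b < 0" and u: "mink a a = 1" "mink b b = 1"
      using ab by (auto simp: N_def pos_def root_unit)
    have "mink (mink z b *\<^sub>R a) (mink z b *\<^sub>R a) = mink (mink z a *\<^sub>R b) (mink z a *\<^sub>R b)"
      using eq by simp
    then have "(mink z b)\<^sup>2 = (mink z a)\<^sup>2" using u by (simp add: mink_linear power2_eq_square)
    then have "mink z b = mink z a" using neg by (simp add: power2_eq_iff)
    with eq have "mink z a *\<^sub>R a = mink z a *\<^sub>R b" by (simp only:)
    moreover have "mink z a \<noteq> 0" using neg(1) by linarith
    ultimately have "a = b" by (simp only: scaleR_cancel_left simp_thms)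
    with ab(3) show False by simp
  qed
  moreover have "finite A" using \<open>finite N\<close> by (simp add: A_def)
  ultimately obtain q where q: "q \<in> open_chamber" "\<And>v. v \<in> A \<Longrightarrow> mink q v \<noteq> 0"
    using generic_point[OF open_open_chamber] base_open_chamber by blast
  \<comment> \<open>\<open>f a\<close> is the parameter at which the segment from \<open>q\<close> to \<open>z\<close>, up to reparametrisation, meets
    the mirror of \<open>a\<close>; the genericity of \<open>q\<close> makes the first mirror unique, hence a wall.\<close>
  define f where "f a = mink q a / (- mink z a)" for a
  have "finite (f ` N)" "f ` N \<noteq> {}" using \<open>finite N\<close> \<open>N \<noteq> {}\<close> by auto
  then have "Min (f ` N) \<in> f ` N" by (rule Min_in)
  then obtain b where b: "b \<in> N" "f b = Min (f ` N)" by auto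
  have less: "f b < f a" if "a \<in> N" "a \<noteq> b" for a
  proof -
    have "mink z a *\<^sub>R b - mink z b *\<^sub>R a \<in> A" using that b(1) unfolding A_def by blast
    from q(2)[OF this] have "mink z a * mink q b \<noteq> mink z b * mink q a" by (simp add: mink_linear)
    moreover have "mink z a < 0" "mink z b < 0" using that b by (auto simp: N_def)
    ultimately have "f b \<noteq> f a" by (simp add: f_def field_simps)
    moreover have "f b \<le> f a" using b(2) that \<open>finite N\<close> by simp
    ultimately show ?thesis by simp
  qed
  have bp: "b \<in> pos" and zb: "mink z b < 0" using b by (auto simp: N_def)
  have qpos: "mink q a > 0" if "a \<in> pos" for a using q(1) that by (simp add: open_chamber_def)
  have fb: "f b > 0" using qpos[OF bp] zb by (simp add: f_def divide_pos_neg zero_less_divide_iff)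
  have "reflect b a \<in> pos" if a: "a \<in> pos" "a \<noteq> b" for a
  proof (rule ccontr)
    assume n: "reflect b a \<notin> pos"
    define a' where "a' = - reflect b a"
    have a': "a' \<in> pos" using n root_cases[OF root_reflect[OF pos_root[OF bp] pos_root[OF a(1)]]]
      unfolding a'_def by blast
    have sum: "a + a' = (2 * mink a b) *\<^sub>R b" by (simp add: a'_def reflect_def)
    have ne: "a' \<noteq> b"
    proof
      assume "a' = b"
      then have ra: "reflect b a = - b" unfolding a'_def by (metis minus_minus)
      have bb: "mink b b = 1" using bp by (simp add: root_unit pos_root)
      have "a = reflect b (reflect b a)" using bb by simp
      also have "\<dots> = b" unfolding ra using bb by (simp add: reflect_def mink_linear scaleR_2)
      finally show False using a(2) by simp
    qed
    \<comment> \<open>In other words q + f b z, the crossing point up to scale, is positive on every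
      positive root other than b and zero on b. Hence a + a' is positive there, while the multiple
      of b to which it equals is zero.\<close>
    have key: "mink q c > f b * (- mink z c)" if c: "c \<in> pos" "c \<noteq> b" for c
    proof (cases "c \<in> N")
      case True
      then have "mink z c < 0" by (simp add: N_def)
      then have "- mink z c > 0" by simp
      with less[OF True c(2)] show ?thesis unfolding f_def[of c] by (simp only: pos_less_divide_eq)
    next
      case False
      then have "- mink z c \<le> 0" using c by (simp add: N_def)
      then have "f b * (- mink z c) \<le> 0" using fb by (simp add: mult_nonneg_nonpos)
      also have "0 < mink q c" using qpos c by blast
      finally show ?thesis .
    qed
    have "mink q a + mink q a' > f b * (- (mink z a + mink z a'))"
      using key[OF a] key[OF a' ne] by (simp add: algebra_simps)
    moreover have "mink q a + mink q a' = 2 * mink a b * mink q b"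
      "mink z a + mink z a' = 2 * mink a b * mink z b"
      using arg_cong[OF sum, of "mink q"] arg_cong[OF sum, of "mink z"] by (simp_all add: mink_linear)
    moreover have "f b * (- (2 * mink a b * mink z b)) = 2 * mink a b * mink q b"
      using zb by (simp add: f_def)
    ultimately show False by simp
  qed
  then have "b \<in> simple" using bp by (simp add: simple_def)
  with zb that show ?thesis by blast
qed

text \<open>A larger product means a smaller distance to q, so this picks the orbit point nearest to
  q under simple reflections. Were it outside the chamber, reflecting in a simple root that is
  negative on it would bring it nearer. Maximality among all simple words is recorded because it
  becomes the Dirichlet inequality.\<close>

lemma maximal_word:
  assumes x: "x \<in> hyperbolic_space" and q: "q \<in> hyperbolic_space" "q \<in> open_chamber"
  obtains bs where "set bs \<subseteq> simple" "word bs x \<in> closed_chamber"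
    "\<And>cs. set cs \<subseteq> simple \<Longrightarrow> mink (word cs x) q \<le> mink (word bs x) q"
proof -
  define T where "T = {w \<in> W. (\<exists>cs. set cs \<subseteq> simple \<and> (\<forall>y. blinfun_apply w y = word cs y)) \<and>
    mink (blinfun_apply w x) q \<ge> mink x q}"
  \<comment> \<open>Elements of T move x no farther from q than x itself, so
    \<open>fst_le_mink\<close> bounds the time coordinate of w x by 2 q_0 (-[x, q]), and
    \<open>norm_hyperbolic\<close> doubles this.\<close>
  define M where "M = max (norm x) (2 * (2 * fst q * (- mink x q)))"
  have fq: "fst q > 0" using q(1) by (simp add: hyperbolic_space_def)
  have "T \<subseteq> {w \<in> W. \<exists>x\<in>hyperbolic_space. norm x \<le> M \<and> norm (blinfun_apply w x) \<le> M}"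
  proof
    fix w assume w: "w \<in> T"
    then have wx: "w \<in> W" "blinfun_apply w x \<in> hyperbolic_space" using x by (auto simp: T_def hyperbolic_apply)
    have "norm (blinfun_apply w x) \<le> 2 * fst (blinfun_apply w x)" by (rule norm_hyperbolic[OF wx(2)])
    also have "\<dots> \<le> 2 * (2 * fst q * (- mink (blinfun_apply w x) q))"
      using fst_le_mink[OF wx(2) q(1)] by simp
    also have "\<dots> \<le> 2 * (2 * fst q * (- mink x q))" using w fq by (simp add: T_def)
    finally have "norm (blinfun_apply w x) \<le> M" by (simp add: M_def)
    moreover have "norm x \<le> M" by (simp add: M_def)
    ultimately show "w \<in> {w \<in> W. \<exists>x\<in>hyperbolic_space. norm x \<le> M \<and> norm (blinfun_apply w x) \<le> M}"
      using wx(1) x by blast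
  qed
  then have "finite T" using properly_discontinuous finite_subset by blast
  moreover have "id_blinfun \<in> T"
    using id_in by (auto simp: T_def intro!: exI[of _ "[]"])
  ultimately have fin: "finite ((\<lambda>w. mink (blinfun_apply w x) q) ` T)" "(\<lambda>w. mink (blinfun_apply w x) q) ` T \<noteq> {}"
    by auto
  from Max_in[OF this] obtain w where w: "w \<in> T"
    and wm: "mink (blinfun_apply w x) q = Max ((\<lambda>w. mink (blinfun_apply w x) q) ` T)" by auto
  have max: "mink (blinfun_apply v x) q \<le> mink (blinfun_apply w x) q" if "v \<in> T" for v
    using Max_ge[OF fin(1)] that wm by auto
  from w obtain bs where bs: "set bs \<subseteq> simple" "\<And>y. blinfun_apply w y = word bs y" by (auto simp: T_def)
  have best: "mink (word cs x) q \<le> mink (word bs x) q" if cs: "set cs \<subseteq> simple" for cs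
  proof (cases "mink (word cs x) q \<ge> mink x q")
    case True
    from cs have "set cs \<subseteq> roots" using simple_root by blast
    then obtain v where v: "v \<in> W" "\<And>y. blinfun_apply v y = word cs y" by (rule word_in_group) blast
    with cs True have "v \<in> T" by (auto simp: T_def)
    from max[OF this] show ?thesis by (simp add: v bs)
  next
    case False
    then show ?thesis using w bs(2) by (simp add: T_def)
  qed
  have "word bs x \<in> closed_chamber"
  proof (rule ccontr)
    assume n: "word bs x \<notin> closed_chamber"
    have "word bs x \<in> future_cone"
      using w x bs(2)[of x] hyperbolic_apply[of w x] by (simp add: T_def hyperbolic_future)
    then obtain b where b: "b \<in> simple" "mink (word bs x) b < 0"
      using n by (rule exists_simple_negative)
    have "mink q b > 0" using b(1) q(2) by (simp add: simple_def open_chamber_def)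
    have "mink (word (b # bs) x) q = mink (word bs x) q - 2 * (mink (word bs x) b * mink q b)"
      by (simp add: reflect_def mink_linear mink_commute[of b q])
    also have "\<dots> > mink (word bs x) q" using mult_neg_pos[OF b(2) \<open>mink q b > 0\<close>] by linarith
    finally show False using best[of "b # bs"] b(1) bs(1) by simp
  qed
  with that bs(1) best show ?thesis by blast
qed

text \<open>P is the orthogonal projection to the mirror of a, and P p stays timelike because a
  spacelike component was removed. As [P x, b] = [x, P b] and P b is nonzero unless b is a or -a, a
  generic x projects to a point on no other mirror.\<close>

lemma generic_point_on_mirror:
  assumes a: "a \<in> roots"
  obtains y where "y \<in> hyperbolic_space" "mink y a = 0"
    "\<And>b. b \<in> roots \<Longrightarrow> b \<noteq> a \<Longrightarrow> b \<noteq> - a \<Longrightarrow> mink y b \<noteq> 0"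
proof -
  have aa: "mink a a = 1" using a by (rule root_unit)
  define P where "P x = x - mink x a *\<^sub>R a" for x
  have Pa: "mink (P x) a = 0" for x using aa by (simp add: P_def mink_linear)
  define q where "q = P p"
  have pq: "mink p q = -1 - (mink p a)\<^sup>2"
    using base by (simp add: q_def P_def mink_linear hyperbolic_mink power2_eq_square)
  have qq: "mink q q = mink p q"
    using mink.diff_right[of q p "mink p a *\<^sub>R a"] Pa[of p]
    unfolding q_def[symmetric] P_def[of p, folded q_def, symmetric]
    by (simp add: mink.scaleR_right mink_commute[of p q])
  have neg: "mink p q < 0" using pq zero_le_power2[of "mink p a"] by linarith
  then have "q \<in> future_cone" using qq by (intro timelike_future[OF hyperbolic_future[OF base]]) auto
  then obtain e where e: "e > 0" "cball q e \<subseteq> future_cone"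
    using open_future_cone open_contains_cball by blast
  define F where "F = {b \<in> roots. \<exists>x\<in>cball q e. mink x b = 0}"
  have F: "finite F" unfolding F_def by (rule locally_finite_roots) (use e in auto)
  define A where "A = P ` (F - {a, - a})"
  have "0 \<notin> A"
  proof
    assume "0 \<in> A"
    then obtain b where bF: "b \<in> F - {a, - a}" "0 = P b" unfolding A_def by blast
    then have b: "b \<in> roots" "b \<noteq> a" "b \<noteq> - a" by (auto simp: F_def)
    have e': "b = mink b a *\<^sub>R a" using bF(2) by (simp add: P_def)
    have "mink b b = mink b a * mink b a"
      using arg_cong[OF e', of "\<lambda>v. mink v b"] by (simp add: mink.scaleR_left mink_commute[of a b])
    then have "mink b a = 1 \<or> mink b a = -1" using root_unit[OF b(1)] by (simp add: square_eq_1_iff)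
    then show False using b(2,3) e' by (metis scaleR_one scaleR_minus1_left)
  qed
  define G where "G = P -` ball q e"
  have "continuous_on UNIV P"
    unfolding P_def by (intro continuous_intros mink.continuous_on)
  then have "open G" unfolding G_def by (rule open_vimage[OF open_ball])
  moreover have "P q = q" using Pa[of p, folded q_def] by (simp add: P_def[of q])
  then have "q \<in> G" using e by (simp add: G_def)
  ultimately obtain x where x: "x \<in> G" "\<And>v. v \<in> A \<Longrightarrow> mink x v \<noteq> 0"
    using generic_point[of G A] F \<open>0 \<notin> A\<close> by (auto simp: A_def)
  define y where "y = P x"
  have yq: "y \<in> cball q e" using x(1) by (simp add: y_def G_def)
  have yb: "mink y b \<noteq> 0" if "b \<in> roots" "b \<noteq> a" "b \<noteq> - a" for b
  proof (cases "b \<in> F")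
    case True
    then have "mink x (P b) \<noteq> 0" using that x(2) by (simp add: A_def)
    moreover have "mink x (P b) = mink y b"
      by (simp add: y_def P_def mink_linear mink_commute[of a b])
    ultimately show ?thesis by simp
  next
    case False
    then show ?thesis using that yq by (auto simp: F_def)
  qed
  have yf: "y \<in> future_cone" using yq e by blast
  have nz: "mink (normalize_time y) b = 0 \<longleftrightarrow> mink y b = 0" for b
    using yf by (simp add: normalize_time_def mink_linear future_cone_def)
  show ?thesis
  proof (rule that)
    show "normalize_time y \<in> hyperbolic_space" using yf by (rule normalize_time_hyperbolic)
    show "mink (normalize_time y) a = 0" unfolding nz by (simp add: y_def Pa)
    show "mink (normalize_time y) b \<noteq> 0" if "b \<in> roots" "b \<noteq> a" "b \<noteq> - a" for b
      unfolding nz using yb that by blast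
  qed
qed

text \<open>A simple word moves a generic point y of the mirror into the closed chamber. The only
  mirror through the image is that of a', and its reflection fixes the image, where all other
  positive roots are strictly positive; so it permutes them and a' is simple. Conjugating back gives
  the word.\<close>

lemma reflection_simple_word:
  assumes a: "a \<in> roots"
  obtains bs where "set bs \<subseteq> simple" "\<And>x. reflect a x = word bs x"
proof -
  obtain y where y: "y \<in> hyperbolic_space" "mink y a = 0"
    "\<And>b. b \<in> roots \<Longrightarrow> b \<noteq> a \<Longrightarrow> b \<noteq> - a \<Longrightarrow> mink y b \<noteq> 0"
    by (rule generic_point_on_mirror[OF a]) blast
  obtain bs where bs: "set bs \<subseteq> simple" "word bs y \<in> closed_chamber"
    by (rule maximal_word[OF y(1) base base_open_chamber]) blast
  then have bsr: "set bs \<subseteq> roots" using simple_root by blast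
  then obtain w where w: "w \<in> W" "\<And>x. blinfun_apply w x = word bs x" by (rule word_in_group) blast
  obtain v where v: "v \<in> W"
    "\<And>x. blinfun_apply v (blinfun_apply w x) = x" "\<And>x. blinfun_apply w (blinfun_apply v x) = x"
    by (rule obtain_inverse[OF w(1)]) blast
  have rv: "word (rev bs) (word bs x) = x" for x
    using bsr by (intro word_rev) (auto simp: root_unit)
  define a' where "a' = (if blinfun_apply w a \<in> pos then blinfun_apply w a else - blinfun_apply w a)"
  have a'pos: "a' \<in> pos" using root_cases[OF root_apply[OF w(1) a]] by (auto simp: a'_def)
  have a'0: "mink (word bs y) a' = 0"
    using mink_apply[OF w(1), of y a] y(2) by (simp add: a'_def w(2)[symmetric] mink_linear)
  have refl': "reflect a' x = reflect (blinfun_apply w a) x" for x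
    by (simp add: a'_def reflect_def mink_linear)
  have "reflect a' b \<in> pos" if b: "b \<in> pos" "b \<noteq> a'" for b
  proof -
    have vb: "blinfun_apply v b \<in> roots" using v(1) b pos_root root_apply by blast
    have "mink (word bs y) b = mink y (blinfun_apply v b)"
      using mink_apply[OF w(1), of y "blinfun_apply v b"] by (simp add: v(3) w(2)[symmetric])
    moreover have "mink y (blinfun_apply v b) \<noteq> 0"
    proof (rule y(3)[OF vb])
      show "blinfun_apply v b \<noteq> a"
      proof
        assume "blinfun_apply v b = a"
        then have "b = blinfun_apply w a" using v(3) by metis
        with b show False by (simp add: a'_def)
      qed
      show "blinfun_apply v b \<noteq> - a"
      proof
        assume "blinfun_apply v b = - a"
        then have "b = - blinfun_apply w a" using v(3) by (metis blinfun.minus_right)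
        with b a'pos show False by (auto simp: a'_def pos_def mink_linear split: if_splits)
      qed
    qed
    moreover have "mink (word bs y) b \<ge> 0" using bs(2) b by (simp add: closed_chamber_def)
    ultimately have "mink (word bs y) b > 0" by simp
    moreover have "mink (word bs y) (reflect a' b) = mink (word bs y) b"
      using a'0 by (simp add: reflect_def mink_linear)
    ultimately show ?thesis
      using root_pos_if[OF bs(2) root_reflect] a'pos b pos_root by simp
  qed
  then have sa: "a' \<in> simple" using a'pos by (simp add: simple_def)
  have "reflect a x = word (rev bs @ a' # bs) x" for x
  proof -
    have "word bs (reflect a x) = reflect a' (word bs x)"
      unfolding refl' w(2)[symmetric] using mink_apply[OF w(1), of x a]
      by (simp add: reflect_def blinfun.diff_right blinfun.scaleR_right)
    then have "word (rev bs) (word bs (reflect a x)) = word (rev bs @ a' # bs) x"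
      by (simp add: word_append)
    then show ?thesis by (simp add: rv)
  qed
  then show ?thesis using that[of "rev bs @ a' # bs"] bs(1) sa by simp
qed

section \<open>Exchange, freeness and the Dirichlet property\<close>

lemma simple_word:
  assumes w: "w \<in> W"
  obtains bs where "set bs \<subseteq> simple" "\<And>x. blinfun_apply w x = word bs x"
proof -
  from generated[OF w] obtain as where as: "set as \<subseteq> roots" "\<forall>x. blinfun_apply w x = word as x" by blast
  from as(1) have "\<exists>bs. set bs \<subseteq> simple \<and> (\<forall>x. word as x = word bs x)"
  proof (induction as)
    case Nil
    then show ?case by (auto intro: exI[of _ "[]"])
  next
    case (Cons a as)
    then obtain bs where bs: "set bs \<subseteq> simple" "\<And>x. word as x = word bs x" by auto
    from Cons have "a \<in> roots" by simp
    then obtain cs where cs: "set cs \<subseteq> simple" "\<And>x. reflect a x = word cs x"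
      by (rule reflection_simple_word) blast
    show ?case using bs cs by (intro exI[of _ "cs @ bs"]) (auto simp: word_append)
  qed
  with as(2) that show ?thesis by auto
qed

text \<open>Move the reflection in b rightwards through the word: past a letter c different from b
  it becomes the reflection in \<open>reflect c b\<close>, which is again positive. Since p itself
  is positive on b, at some letter the two must coincide, and there they cancel.\<close>

lemma exchange:
  assumes "set cs \<subseteq> simple" "b \<in> pos" "mink (word cs p) b < 0"
  shows "\<exists>cs'. set cs' \<subseteq> simple \<and> length cs = Suc (length cs') \<and> (\<forall>x. reflect b (word cs x) = word cs' x)"
  using assms
proof (induction cs arbitrary: b)
  case Nil
  then show ?case by (simp add: pos_def)
next
  case (Cons c cs)
  have cu: "mink c c = 1" using Cons.prems simple_root by (auto simp: root_unit)
  show ?case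
  proof (cases "b = c")
    case True
    with Cons.prems cu show ?thesis by (intro exI[of _ cs]) auto
  next
    case False
    then have cb: "reflect c b \<in> pos" using Cons.prems by (simp add: simple_def)
    have "mink (word cs p) (reflect c b) < 0" using Cons.prems by (simp add: mink_reflect_left)
    with Cons.IH[OF _ cb] Cons.prems obtain cs' where
      cs': "set cs' \<subseteq> simple" "length cs = Suc (length cs')"
        "\<And>x. reflect (reflect c b) (word cs x) = word cs' x" by auto
    have conj: "reflect b (reflect c x) = reflect c (reflect (reflect c b) x)" for x
    proof -
      have "reflect c (reflect (reflect c b) x) = reflect c x - (2 * mink x (reflect c b)) *\<^sub>R reflect c (reflect c b)"
        by (simp add: reflect_def[of "reflect c b" x]) (simp add: reflect_def mink_linear algebra_simps)
      also have "\<dots> = reflect b (reflect c x)"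
        using cu by (simp add: reflect_def[of b] mink_reflect_left)
      finally show ?thesis by simp
    qed
    have "reflect b (word (c # cs) x) = word (c # cs') x" for x by (simp add: conj cs'(3))
    then show ?thesis using cs' Cons.prems by (intro exI[of _ "c # cs'"]) auto
  qed
qed

text \<open>If the image of p is positive on the first letter b, the image under the remaining word
  is negative on b, so exchange cancels b against one of the remaining letters. The word becomes two
  letters shorter with the same action.\<close>

lemma simple_word_identity:
  assumes "set bs \<subseteq> simple" "word bs p \<in> open_chamber"
  shows "word bs x = x"
  using assms
proof (induction "length bs" arbitrary: bs rule: less_induct)
  case less
  show ?case
  proof (cases bs)
    case (Cons b cs)
    with less.prems have b: "b \<in> simple" "b \<in> pos" "set cs \<subseteq> simple" by (auto simp: simple_def)
    have "mink (word bs p) b > 0" using less.prems(2) b by (simp add: open_chamber_def)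
    then have "mink (word cs p) b < 0" using Cons root_unit[OF pos_root[OF b(2)]] by simp
    from exchange[OF b(3,2) this] obtain cs' where
      cs': "set cs' \<subseteq> simple" "length cs = Suc (length cs')" "\<And>x. word bs x = word cs' x"
      by (auto simp: Cons)
    then show ?thesis using less.hyps[of cs'] less.prems(2) Cons by simp
  qed simp
qed

text \<open>The inverse of w sends positive roots to roots that are nonnegative, hence positive, at
  the interior point x. So w p lies in the open chamber too, and \<open>simple_word_identity\<close>
  applies.\<close>

lemma free_action:
  assumes w: "w \<in> W" and x: "x \<in> open_chamber" "blinfun_apply w x \<in> closed_chamber"
  shows "w = id_blinfun"
proof -
  obtain bs where bs: "set bs \<subseteq> simple" "\<And>x. blinfun_apply w x = word bs x"
    by (rule simple_word[OF w]) blast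
  obtain v where v: "v \<in> W"
    "\<And>x. blinfun_apply v (blinfun_apply w x) = x" "\<And>x. blinfun_apply w (blinfun_apply v x) = x"
    by (rule obtain_inverse[OF w]) blast
  have "blinfun_apply w p \<in> open_chamber"
    unfolding open_chamber_def
  proof (intro CollectI conjI ballI)
    show "blinfun_apply w p \<in> future_cone" using w base by (simp add: future_apply hyperbolic_future)
    fix b assume b: "b \<in> pos"
    have vb: "blinfun_apply v b \<in> roots" using v(1) b pos_root root_apply by blast
    have m: "mink (blinfun_apply w y) b = mink y (blinfun_apply v b)" for y
      using mink_apply[OF w, of y "blinfun_apply v b"] by (simp add: v(3))
    have "mink x (blinfun_apply v b) \<noteq> 0" using root_open_chamber_ne[OF x(1) vb] .
    moreover have "mink x (blinfun_apply v b) \<ge> 0" using x(2) b by (simp add: m[symmetric] closed_chamber_def)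
    ultimately have "mink x (blinfun_apply v b) > 0" by simp
    then have "blinfun_apply v b \<in> pos" using root_pos_if vb x(1) open_subset_closed by blast
    then show "mink (blinfun_apply w p) b > 0" by (simp add: m pos_def)
  qed
  then have "word bs x = x" for x using simple_word_identity bs by simp
  then show ?thesis by (intro blinfun_eqI) (simp add: bs(2))
qed

text \<open>The maximising word moves an interior point into the closed chamber, hence is the
  identity by freeness; so the point itself attains the maximum. Normalising both points only scales
  the inequality by s * t.\<close>

lemma mink_apply_le_open:
  assumes w: "w \<in> W" and x: "x \<in> open_chamber" "y \<in> open_chamber"
  shows "mink (blinfun_apply w x) y \<le> mink x y"
proof -
  from x obtain s where s: "s > 0" "normalize_time x \<in> hyperbolic_space" "x = s *\<^sub>R normalize_time x"
    using future_cone_normalize chamber_future by blast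
  from x obtain t where t: "t > 0" "normalize_time y \<in> hyperbolic_space" "y = t *\<^sub>R normalize_time y"
    using future_cone_normalize chamber_future by blast
  define h k where "h = normalize_time x" and "k = normalize_time y"
  have hk: "h \<in> open_chamber" "k \<in> open_chamber"
    using x by (simp_all add: h_def k_def chamber_normalize)
  have "h \<in> hyperbolic_space" "k \<in> hyperbolic_space" using s t by (simp_all add: h_def k_def)
  then obtain bs where bs: "set bs \<subseteq> simple" "word bs h \<in> closed_chamber"
    "\<And>cs. set cs \<subseteq> simple \<Longrightarrow> mink (word cs h) k \<le> mink (word bs h) k"
    using maximal_word[OF _ _ hk(2)] by metis
  have "set bs \<subseteq> roots" using bs simple_root by blast
  then obtain v where v: "v \<in> W" "\<And>x. blinfun_apply v x = word bs x" by (rule word_in_group) blast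
  then have "v = id_blinfun" using free_action[OF v(1) hk(1)] bs(2) by simp
  then have "word bs h = h" using v(2)[of h] by simp
  moreover obtain cs where "set cs \<subseteq> simple" "\<And>x. blinfun_apply w x = word cs x"
    by (rule simple_word[OF w]) blast
  ultimately have "mink (blinfun_apply w h) k \<le> mink h k" using bs(3)[of cs] by simp
  then have "s * t * mink (blinfun_apply w h) k \<le> s * t * mink h k" using s t by simp
  moreover have "mink (blinfun_apply w x) y = s * t * mink (blinfun_apply w h) k" "mink x y = s * t * mink h k"
  proof -
    have e: "x = s *\<^sub>R h" "y = t *\<^sub>R k" using s(3) t(3) by (simp_all add: h_def k_def)
    show "mink (blinfun_apply w x) y = s * t * mink (blinfun_apply w h) k" "mink x y = s * t * mink h k"
      unfolding e by (simp_all add: blinfun.scaleR_right mink.scaleR_left mink.scaleR_right)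
  qed
  ultimately show ?thesis by simp
qed

text \<open>A closed chamber is a Dirichlet domain for each of its points.\<close>
lemma mink_apply_le:
  assumes w: "w \<in> W" and x: "x \<in> closed_chamber" "y \<in> closed_chamber"
  shows "mink (blinfun_apply w x) y \<le> mink x y"
proof -
  have "((\<lambda>t. mink (x + t *\<^sub>R p) (y + t *\<^sub>R p)) \<longlongrightarrow> mink (x + 0 *\<^sub>R p) (y + 0 *\<^sub>R p)) (at_right 0)"
    by (intro mink.tendsto tendsto_intros)
  then have l1: "((\<lambda>t. mink (x + t *\<^sub>R p) (y + t *\<^sub>R p)) \<longlongrightarrow> mink x y) (at_right 0)" by simp
  have "((\<lambda>t. mink (blinfun_apply w (x + t *\<^sub>R p)) (y + t *\<^sub>R p)) \<longlongrightarrow>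
      mink (blinfun_apply w (x + 0 *\<^sub>R p)) (y + 0 *\<^sub>R p)) (at_right 0)"
    by (intro mink.tendsto tendsto_intros)
  then have l2: "((\<lambda>t. mink (blinfun_apply w (x + t *\<^sub>R p)) (y + t *\<^sub>R p)) \<longlongrightarrow>
      mink (blinfun_apply w x) y) (at_right 0)" by simp
  have "\<forall>\<^sub>F t in at_right 0. mink (blinfun_apply w (x + t *\<^sub>R p)) (y + t *\<^sub>R p)
      \<le> mink (x + t *\<^sub>R p) (y + t *\<^sub>R p)"
    using eventually_at_right_less[of 0]
  proof (rule eventually_mono)
    fix t :: real assume "0 < t"
    then have "x + t *\<^sub>R p \<in> open_chamber" "y + t *\<^sub>R p \<in> open_chamber"
      using x base_open_chamber by (auto intro: closed_open_add open_chamber_scale)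
    then show "mink (blinfun_apply w (x + t *\<^sub>R p)) (y + t *\<^sub>R p) \<le> mink (x + t *\<^sub>R p) (y + t *\<^sub>R p)"
      by (rule mink_apply_le_open[OF w])
  qed
  from tendsto_le[OF _ l1 l2 this] show ?thesis by simp
qed

end

section \<open>Folding onto the fundamental domain\<close>

context chamber
begin

text \<open>As a function of y, [w x - x, y] is linear and nonpositive on the open chamber, so a
  zero there forces w x = x.\<close>

lemma mink_apply_eq:
  assumes w: "w \<in> W" and x: "x \<in> closed_chamber" and y: "y \<in> open_chamber"
    and eq: "mink (blinfun_apply w x) y = mink x y"
  shows "blinfun_apply w x = x"
proof -
  define d where "d = blinfun_apply w x - x"
  have le: "mink d z \<le> 0" if "z \<in> open_chamber" for z
    using mink_apply_le[OF w x, of z] that open_subset_closed by (auto simp: d_def mink_linear)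
  have dy: "mink d y = 0" using eq by (simp add: d_def mink_linear)
  have "d = 0" using mink_open_zero[OF open_open_chamber y le dy] by blast
  then show ?thesis by (simp add: d_def)
qed

text \<open>Applying the inverse of w' turns the hypothesis into equality in the Dirichlet
  inequality, and freeness then gives the identity. Both disjointness claims reduce to this.\<close>

lemma group_element_unique:
  assumes w: "w \<in> W" "w' \<in> W" and x: "x \<in> open_chamber" "x' \<in> open_chamber"
    and eq: "mink (blinfun_apply w x) (blinfun_apply w' x') = mink x x'"
  shows "w = w'"
proof -
  obtain v where v: "v \<in> W" "\<And>x. blinfun_apply v (blinfun_apply w' x) = x"
    "\<And>x. blinfun_apply w' (blinfun_apply v x) = x"
    by (rule obtain_inverse[OF w(2)]) blast
  have vw: "v o\<^sub>L w \<in> W" using v w by (intro comp_in)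
  have "mink (blinfun_apply (v o\<^sub>L w) x) x' = mink (blinfun_apply w x) (blinfun_apply w' x')"
    using mink_apply[OF w(2), of "blinfun_apply v (blinfun_apply w x)" x'] by (simp add: v(3))
  moreover have xc: "x \<in> closed_chamber" using x(1) open_subset_closed by blast
  ultimately have "blinfun_apply (v o\<^sub>L w) x = x"
    using eq by (intro mink_apply_eq[OF vw _ x(2)]) auto
  then have id: "v o\<^sub>L w = id_blinfun" using free_action[OF vw x(1)] xc by simp
  have "blinfun_apply w y = blinfun_apply w' y" for y
    using v(3)[of "blinfun_apply w y"] arg_cong[OF id, of "\<lambda>f. blinfun_apply f y"] by simp
  then show ?thesis by (rule blinfun_eqI)
qed

section \<open>The folding map and its continuity\<close>

definition fundamental where "fundamental = closed_chamber \<inter> hyperbolic_space"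

text \<open>The chain -1 = [w x, w x] \<le> [x, w x] \<le> -1 consists of equalities; the last one
  means w x = x.\<close>

lemma fundamental_unique:
  assumes "w \<in> W" "x \<in> fundamental" "blinfun_apply w x \<in> fundamental"
  shows "blinfun_apply w x = x"
proof -
  have "-1 = mink (blinfun_apply w x) (blinfun_apply w x)"
    using assms(3) by (simp add: fundamental_def hyperbolic_mink)
  also have "\<dots> \<le> mink x (blinfun_apply w x)"
    using assms by (intro mink_apply_le) (auto simp: fundamental_def)
  finally have "mink x (blinfun_apply w x) = -1"
    using mink_hyperbolic_le[of x "blinfun_apply w x"] assms by (simp add: fundamental_def)
  then show ?thesis using mink_hyperbolic_eq[of x "blinfun_apply w x"] assms by (simp add: fundamental_def)
qed

text \<open>By \<open>fundamental_unique\<close> an orbit meets \<open>fundamental\<close> in at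
  most one point, so the choice is determined.\<close>

definition fold_point where
  "fold_point x = (SOME z. z \<in> fundamental \<and> (\<exists>w\<in>W. x = blinfun_apply w z))"

lemma fold_point:
  assumes x: "x \<in> hyperbolic_space"
  shows "fold_point x \<in> fundamental" "\<exists>w\<in>W. x = blinfun_apply w (fold_point x)"
proof -
  obtain bs where bs: "set bs \<subseteq> simple" "word bs x \<in> closed_chamber"
    by (rule maximal_word[OF x base base_open_chamber]) blast
  then have "set bs \<subseteq> roots" using simple_root by blast
  then obtain w where w: "w \<in> W" "\<And>x. blinfun_apply w x = word bs x" by (rule word_in_group) blast
  obtain v where v: "v \<in> W" "\<And>x. blinfun_apply v (blinfun_apply w x) = x"
    by (rule obtain_inverse[OF w(1)]) blast
  have "blinfun_apply w x \<in> fundamental"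
    using bs(2) hyperbolic_apply[OF w(1) x] by (simp add: fundamental_def w(2))
  moreover have "x = blinfun_apply v (blinfun_apply w x)" by (simp add: v(2))
  ultimately have "\<exists>z. z \<in> fundamental \<and> (\<exists>w\<in>W. x = blinfun_apply w z)" using v(1) by blast
  then have "fold_point x \<in> fundamental \<and> (\<exists>w\<in>W. x = blinfun_apply w (fold_point x))"
    unfolding fold_point_def by (rule someI_ex)
  then show "fold_point x \<in> fundamental" "\<exists>w\<in>W. x = blinfun_apply w (fold_point x)" by blast+
qed

text \<open>Folding is nonexpansive, a larger product being a smaller distance: after moving y to
  its fold by a group element, this is the Dirichlet inequality.\<close>

lemma fold_point_mink_le:
  assumes "x \<in> hyperbolic_space" "y \<in> hyperbolic_space"
  shows "mink x y \<le> mink (fold_point x) (fold_point y)"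
proof -
  obtain u where u: "u \<in> W" "x = blinfun_apply u (fold_point x)" using fold_point(2)[OF assms(1)] by blast
  obtain v where v: "v \<in> W" "y = blinfun_apply v (fold_point y)" using fold_point(2)[OF assms(2)] by blast
  obtain v' where v': "v' \<in> W" "\<And>x. blinfun_apply v' (blinfun_apply v x) = x"
    by (rule obtain_inverse[OF v(1)]) blast
  have "mink x y = mink (blinfun_apply v' x) (blinfun_apply v' y)" using v'(1) by (simp add: mink_apply)
  also have "blinfun_apply v' y = fold_point y" using v(2) v'(2) by metis
  also have "blinfun_apply v' x = blinfun_apply (v' o\<^sub>L u) (fold_point x)" using u(2) by simp
  also have "mink (blinfun_apply (v' o\<^sub>L u) (fold_point x)) (fold_point y) \<le> mink (fold_point x) (fold_point y)"
    using fold_point(1) assms u(1) v'(1) by (intro mink_apply_le comp_in) (auto simp: fundamental_def)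
  finally show ?thesis .
qed

lemma closed_fundamental: "closed fundamental"
proof -
  have "fundamental = hyperbolic_space \<inter> (\<Inter>a\<in>pos. {x. mink x a \<ge> 0})"
    by (auto simp: fundamental_def closed_chamber_def hyperbolic_future)
  moreover have "closed (hyperbolic_space \<inter> (\<Inter>a\<in>pos. {x. mink x a \<ge> 0}))"
    by (intro closed_Int closed_hyperbolic_space closed_INT ballI closed_Collect_le mink.continuous_on
        continuous_intros)
  ultimately show ?thesis by simp
qed

end

locale compact_chamber = chamber W p for W :: "('n::finite minkowski \<Rightarrow>\<^sub>L 'n minkowski) set" and p +
  assumes compact_fundamental: "compact fundamental"
begin

text \<open>The target is compact, so a closed graph suffices. Passing to the limit in
  \<open>fold_point_mink_le\<close> gives a product of at least -1 between the limit of the folds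
  and the fold of the limit, so they agree.\<close>

lemma continuous_on_fold_point: "continuous_on hyperbolic_space fold_point"
proof (rule continuous_from_closed_graph[OF compact_fundamental])
  show "fold_point \<in> hyperbolic_space \<rightarrow> fundamental" using fold_point(1) by blast
  show "closed ((\<lambda>x. (x, fold_point x)) ` hyperbolic_space)"
    unfolding closed_sequential_limits
  proof (intro allI impI, elim conjE)
    fix s l
    assume s: "\<forall>n. s n \<in> (\<lambda>x. (x, fold_point x)) ` hyperbolic_space" and l: "s \<longlonglongrightarrow> l"
    have x: "fst (s n) \<in> hyperbolic_space" "snd (s n) = fold_point (fst (s n))" for n
      using s by (metis (no_types, lifting) fst_conv imageE snd_conv)+
    have lx: "(\<lambda>n. fst (s n)) \<longlonglongrightarrow> fst l" and lz: "(\<lambda>n. snd (s n)) \<longlonglongrightarrow> snd l"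
      using l by (auto intro: tendsto_fst tendsto_snd)
    have h: "fst l \<in> hyperbolic_space"
      using closed_sequentially[OF closed_hyperbolic_space _ lx] x(1) by blast
    have "snd l \<in> fundamental"
      using closed_sequentially[OF closed_fundamental _ lz] x fold_point(1) by simp
    then have d: "snd l \<in> hyperbolic_space" by (simp add: fundamental_def)
    have f: "fold_point (fst l) \<in> hyperbolic_space" using fold_point(1)[OF h] by (simp add: fundamental_def)
    have "(\<lambda>n. mink (fst (s n)) (fst l)) \<longlonglongrightarrow> mink (fst l) (fst l)"
      by (intro mink.tendsto lx tendsto_const)
    moreover have "(\<lambda>n. mink (snd (s n)) (fold_point (fst l))) \<longlonglongrightarrow> mink (snd l) (fold_point (fst l))"
      by (intro mink.tendsto lz tendsto_const)
    ultimately have "mink (fst l) (fst l) \<le> mink (snd l) (fold_point (fst l))"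
      using fold_point_mink_le[OF x(1) h] x(2) by (intro LIMSEQ_le) auto
    then have "mink (snd l) (fold_point (fst l)) = -1"
      using mink_hyperbolic_le[OF d f] hyperbolic_mink[OF h] by simp
    then have "snd l = fold_point (fst l)" by (rule mink_hyperbolic_eq[OF d f])
    then have "l = (fst l, fold_point (fst l))" by (simp add: prod_eq_iff)
    then show "l \<in> (\<lambda>x. (x, fold_point x)) ` hyperbolic_space" using h by blast
  qed
qed

text \<open>This includes mirrors that touch D only in a lower-dimensional face. All remaining
  positive roots are strictly positive on D.\<close>

definition wall_roots where "wall_roots = {a \<in> pos. \<exists>x\<in>fundamental. mink x a = 0}"

lemma finite_wall_roots: "finite wall_roots"
proof (rule finite_subset)
  show "wall_roots \<subseteq> {a \<in> roots. \<exists>x\<in>fundamental. mink x a = 0}" by (auto simp: wall_roots_def pos_root)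
  show "finite {a \<in> roots. \<exists>x\<in>fundamental. mink x a = 0}"
    by (intro locally_finite_roots compact_fundamental) (auto simp: fundamental_def hyperbolic_future)
qed

text \<open>
  A vector field supported in the \<open>e\<close>-neighbourhood of the walls. Near a point \<open>x\<^sub>0\<close> of the
  fundamental domain it is a combination of the normals of the walls through \<open>x\<^sub>0\<close>, hence
  orthogonal to \<open>x\<^sub>0\<close>; pushing along it moves fixed points off the walls.
\<close>
definition push where "push e z = (\<Sum>a\<in>wall_roots. max 0 (e - mink z a) *\<^sub>R a)"

lemma norm_push_le:
  assumes "z \<in> fundamental" "e > 0"
  shows "norm (push e z) \<le> e * (\<Sum>a\<in>wall_roots. norm a)"
proof -
  have "norm (push e z) \<le> (\<Sum>a\<in>wall_roots. norm (max 0 (e - mink z a) *\<^sub>R a))"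
    unfolding push_def by (rule norm_sum)
  also have "\<dots> \<le> (\<Sum>a\<in>wall_roots. e * norm a)"
  proof (rule sum_mono)
    fix a assume "a \<in> wall_roots"
    then have "mink z a \<ge> 0" using assms by (simp add: wall_roots_def fundamental_def closed_chamber_def)
    then have "max 0 (e - mink z a) \<le> e" using assms by simp
    then show "norm (max 0 (e - mink z a) *\<^sub>R a) \<le> e * norm a"
      by (simp add: mult_right_mono)
  qed
  finally show ?thesis by (simp add: sum_distrib_left)
qed

lemma mink_push: "mink y (push e z) = (\<Sum>a\<in>wall_roots. max 0 (e - mink z a) * mink y a)"
  by (simp add: push_def mink.sum_right mink.scaleR_right)

section \<open>Fixed points of the perturbed folding map\<close>

lemma fundamental_nonempty: "fundamental \<noteq> {}"
  using base base_open_chamber open_subset_closed by (auto simp: fundamental_def)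

lemma fundamental_future: "x \<in> fundamental \<Longrightarrow> x \<in> future_cone"
  by (simp add: fundamental_def hyperbolic_future)

text \<open>D is not convex in V. Radial projection identifies it with the slice x_0 = 1 of the
  chamber, its Klein model, which is compact and convex, and Brouwer is applied there.\<close>

lemma pushed_fixed_point:
  fixes g :: "'n minkowski \<Rightarrow> 'n minkowski"
  assumes cont: "continuous_on hyperbolic_space g" and gH: "g ` hyperbolic_space \<subseteq> hyperbolic_space"
    and e: "\<And>z. z \<in> fundamental \<Longrightarrow> z + e *\<^sub>R push e z \<in> future_cone"
  obtains u where "u \<in> fundamental"
    "u = fold_point (normalize_time (fold_point (g u) + e *\<^sub>R push e (fold_point (g u))))"
proof -
  define pr where "pr x = (1 / fst x) *\<^sub>R x" for x :: "'n minkowski"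
  define S where "S = {x \<in> closed_chamber. fst x = 1}"
  have fstpos: "fst x > 0" if "x \<in> fundamental" for x
    using fundamental_future[OF that] by (simp add: future_cone_def)
  have prS: "pr x \<in> S" if "x \<in> fundamental" for x
    using that fstpos[OF that] unfolding S_def pr_def
    by (auto intro!: closed_chamber_scale simp: fundamental_def)
  have nS: "normalize_time x \<in> fundamental" if "x \<in> S" for x
    using that chamber_normalize(2)[of x] normalize_time_hyperbolic[OF chamber_future(1)]
    by (simp add: S_def fundamental_def)
  have npr: "normalize_time (pr x) = x" if "x \<in> fundamental" for x
    unfolding pr_def using that fstpos[OF that] by (intro normalize_time_scale) (auto simp: fundamental_def)
  have contpr: "continuous_on fundamental pr"
    unfolding pr_def using fstpos by (intro continuous_intros) force
  have "S = pr ` fundamental"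
  proof
    show "S \<subseteq> pr ` fundamental"
    proof
      fix x assume x: "x \<in> S"
      then have "x \<in> future_cone" "fst x = 1" by (auto simp: S_def chamber_future)
      then obtain t where t: "t > 0" "x = t *\<^sub>R normalize_time x" using future_cone_normalize by blast
      have "t * fst (normalize_time x) = 1" using t(2) \<open>fst x = 1\<close> by (metis fst_scaleR real_scaleR_def)
      then have "1 / fst (normalize_time x) = t" by (metis inverse_unique inverse_eq_divide mult.commute)
      then have "pr (normalize_time x) = x" using t(2) by (simp add: pr_def)
      then show "x \<in> pr ` fundamental" using nS[OF x] by (metis imageI)
    qed
  qed (use prS in blast)
  then have "compact S" "S \<noteq> {}"
    using compact_continuous_image[OF contpr compact_fundamental] fundamental_nonempty by auto
  have "convex S"
  proof (rule convexI)
    fix x y and s t :: real assume xy: "x \<in> S" "y \<in> S" "0 \<le> s" "0 \<le> t" "s + t = 1"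
    then have "s *\<^sub>R x + t *\<^sub>R y \<in> future_cone"
      using convexD[OF convex_future_cone, of x y s t] by (auto simp: S_def chamber_future)
    then show "s *\<^sub>R x + t *\<^sub>R y \<in> S" using xy by (auto simp: S_def closed_chamber_def mink_linear)
  qed
  define h1 where "h1 x = fold_point (g (normalize_time x))" for x
  define h2 where "h2 z = fold_point (normalize_time (z + e *\<^sub>R push e z))" for z
  have n1: "normalize_time x \<in> hyperbolic_space" if "x \<in> S" for x
    using nS[OF that] by (simp add: fundamental_def)
  have n2: "normalize_time (z + e *\<^sub>R push e z) \<in> hyperbolic_space" if "z \<in> fundamental" for z
    using e[OF that] by (rule normalize_time_hyperbolic)
  have h1: "h1 x \<in> fundamental" if "x \<in> S" for x
    unfolding h1_def using n1[OF that] gH by (intro fold_point) blast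
  have h2: "h2 z \<in> fundamental" if "z \<in> fundamental" for z
    unfolding h2_def using n2[OF that] by (rule fold_point)
  have "continuous_on S normalize_time"
    using continuous_on_normalize_time by (rule continuous_on_subset) (auto simp: S_def chamber_future)
  then have "continuous_on S (\<lambda>x. g (normalize_time x))"
    using n1 by (intro continuous_on_compose2[OF cont]) auto
  then have c1: "continuous_on S h1"
    unfolding h1_def using n1 gH by (intro continuous_on_compose2[OF continuous_on_fold_point]) auto
  have "continuous_on fundamental (\<lambda>z. z + e *\<^sub>R push e z)"
    unfolding push_def by (intro continuous_intros mink.continuous_on)
  then have "continuous_on fundamental (\<lambda>z. normalize_time (z + e *\<^sub>R push e z))"
    using e by (intro continuous_on_compose2[OF continuous_on_normalize_time]) auto
  then have c2: "continuous_on fundamental h2"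
    unfolding h2_def using n2 by (intro continuous_on_compose2[OF continuous_on_fold_point]) auto
  have "continuous_on S (\<lambda>x. h2 (h1 x))"
    using h1 by (intro continuous_on_compose2[OF c2 c1]) auto
  then have "continuous_on S (\<lambda>x. pr (h2 (h1 x)))"
    by (rule continuous_on_compose2[OF contpr]) (intro image_subsetI h2 h1)
  moreover have "(\<lambda>x. pr (h2 (h1 x))) \<in> S \<rightarrow> S" using h1 h2 prS by blast
  ultimately obtain x where x: "x \<in> S" "pr (h2 (h1 x)) = x"
    using brouwer[OF \<open>compact S\<close> \<open>convex S\<close> \<open>S \<noteq> {}\<close>] by blast
  define u where "u = h2 (h1 x)"
  have u: "u \<in> fundamental" unfolding u_def using h1 h2 x(1) by blast
  have "normalize_time x = u" using npr[OF u] x(2) by (simp add: u_def)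
  then have "h1 x = fold_point (g u)" by (simp add: h1_def)
  then have "u = h2 (fold_point (g u))" by (simp add: u_def)
  with u that show ?thesis by (simp add: h2_def)
qed

text \<open>
  Let \<open>u\<close> be a fixed point of the pushed map, \<open>z\<close> the fold of \<open>g u\<close> and \<open>c\<close> the push of \<open>z\<close>,
  so that \<open>z + e c = l w' u\<close> with \<open>w' \<in> W\<close>. For small \<open>e\<close> the limit point \<open>x\<^sub>0\<close> is fixed by all
  the transformations involved. Pairing with \<open>x\<^sub>0 \<bottom> c\<close> gives \<open>l = 1\<close>; comparing the norms gives
  \<open>2 [z, c] + e [c, c] = 0\<close> with both terms nonnegative, so \<open>c = 0\<close> and \<open>z\<close> is off the walls.
\<close>
theorem interior_fixed_point:
  fixes g :: "'n minkowski \<Rightarrow> 'n minkowski"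
  assumes cont: "continuous_on hyperbolic_space g" and gH: "g ` hyperbolic_space \<subseteq> hyperbolic_space"
    and iso: "\<And>x y. mink (g x) (g y) = mink x y"
  obtains w u where "w \<in> W" "u \<in> open_chamber" "u \<in> hyperbolic_space" "g u = blinfun_apply w u"
proof -
  obtain r where r: "r > 0" "(\<Union>x\<in>fundamental. ball x r) \<subseteq> future_cone"
    using compact_subset_open_imp_ball_epsilon_subset[OF compact_fundamental open_future_cone]
      fundamental_future by blast
  define B where "B = (\<Sum>a\<in>wall_roots. norm a)"
  have B: "B \<ge> 0" by (simp add: B_def sum_nonneg)
  \<comment> \<open>The bound 1 lets the square of e in the size of e * push be replaced by e; the
    other bound keeps the displacement below the distance r that is safe for the future
    cone.\<close>
  define q where "q = min 1 (r / (B + 1))"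
  have q: "0 < q" "q \<le> 1" "q * B < r"
  proof -
    show "0 < q" "q \<le> 1" using r B by (auto simp: q_def)
    have "q * B < q * (B + 1)" using \<open>0 < q\<close> by simp
    also have "\<dots> \<le> r / (B + 1) * (B + 1)" using B by (intro mult_right_mono) (auto simp: q_def)
    also have "\<dots> = r" using B by simp
    finally show "q * B < r" .
  qed
  define e where "e k = q / (real k + 1)" for k
  have e: "0 < e k" "e k \<le> q" for k using q by (auto simp: e_def field_simps)
  have e0: "e \<longlonglongrightarrow> 0"
  proof -
    have "(\<lambda>k. q * inverse (real (Suc k))) \<longlonglongrightarrow> q * 0"
      by (intro tendsto_mult tendsto_const LIMSEQ_inverse_real_of_nat)
    then show ?thesis by (simp add: e_def[abs_def] field_simps)
  qed
  have small: "norm (e k *\<^sub>R push (e k) z) \<le> e k * B" if "z \<in> fundamental" for k z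
  proof -
    have "norm (e k *\<^sub>R push (e k) z) \<le> e k * (e k * B)"
      using norm_push_le[OF that e(1)] e(1)[of k] by (simp add: B_def mult_left_mono)
    also have "\<dots> \<le> 1 * (e k * B)"
      using e[of k] q B by (intro mult_right_mono) auto
    finally show ?thesis by simp
  qed
  have fut: "z + e k *\<^sub>R push (e k) z \<in> future_cone" if "z \<in> fundamental" for k z
  proof -
    have "norm (e k *\<^sub>R push (e k) z) \<le> e k * B" by (rule small[OF that])
    also have "\<dots> \<le> q * B" using e[of k] B by (intro mult_right_mono) auto
    also have "\<dots> < r" by (rule q)
    finally have "z + e k *\<^sub>R push (e k) z \<in> ball z r" by (simp add: dist_norm)
    with r(2) that show ?thesis by blast
  qed
  have "\<exists>u. u \<in> fundamental \<and>
    u = fold_point (normalize_time (fold_point (g u) + e k *\<^sub>R push (e k) (fold_point (g u))))" for k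
    using pushed_fixed_point[OF cont gH fut] by blast
  then obtain u where u: "\<And>k. u k \<in> fundamental"
    "\<And>k. u k = fold_point (normalize_time (fold_point (g (u k)) + e k *\<^sub>R push (e k) (fold_point (g (u k)))))"
    by metis
  define z where "z k = fold_point (g (u k))" for k
  define y where "y k = normalize_time (z k + e k *\<^sub>R push (e k) (z k))" for k
  have uH: "u k \<in> hyperbolic_space" for k using u(1) by (simp add: fundamental_def)
  have gu: "g (u k) \<in> hyperbolic_space" for k using uH gH by blast
  have z: "z k \<in> fundamental" for k unfolding z_def by (rule fold_point(1)[OF gu])
  have zH: "z k \<in> hyperbolic_space" for k using z by (simp add: fundamental_def)
  have yH: "y k \<in> hyperbolic_space" for k
    unfolding y_def by (rule normalize_time_hyperbolic[OF fut[OF z]])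
  have uy: "u k = fold_point (y k)" for k using u(2)[of k] by (simp add: y_def z_def)
  have "\<exists>w. w \<in> W \<and> g (u k) = blinfun_apply w (z k)" for k
    using fold_point(2)[OF gu[of k]] by (auto simp: z_def)
  then obtain w where w: "\<And>k. w k \<in> W" "\<And>k. g (u k) = blinfun_apply (w k) (z k)" by metis
  have "\<exists>w'. w' \<in> W \<and> y k = blinfun_apply w' (u k)" for k
    using fold_point(2)[OF yH[of k]] uy[of k] by auto
  then obtain w' where w': "\<And>k. w' k \<in> W" "\<And>k. y k = blinfun_apply (w' k) (u k)" by metis
  obtain x0 s where x0: "x0 \<in> fundamental" and s: "strict_mono s" and lu: "(u \<circ> s) \<longlonglongrightarrow> x0"
    using compact_fundamental u(1) unfolding compact_def by metis
  have x0H: "x0 \<in> hyperbolic_space" using x0 by (simp add: fundamental_def)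
  have lu': "(\<lambda>k. u (s k)) \<longlonglongrightarrow> x0" using lu by (simp add: comp_def)
  have lg: "(\<lambda>k. g (u (s k))) \<longlonglongrightarrow> g x0"
    using uH by (intro continuous_on_tendsto_compose[OF cont lu' x0H]) auto
  have gx0: "g x0 \<in> hyperbolic_space" using gH x0H by blast
  define z0 where "z0 = fold_point (g x0)"
  have z0: "z0 \<in> fundamental" unfolding z0_def by (rule fold_point(1)[OF gx0])
  have lz: "(\<lambda>k. z (s k)) \<longlonglongrightarrow> z0"
    unfolding z_def z0_def using gu
    by (intro continuous_on_tendsto_compose[OF continuous_on_fold_point lg gx0]) auto
  have le: "(\<lambda>k. e (s k)) \<longlonglongrightarrow> 0" using LIMSEQ_subseq_LIMSEQ[OF e0 s] by (simp add: comp_def)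
  have "(\<lambda>k. e (s k) *\<^sub>R push (e (s k)) (z (s k))) \<longlonglongrightarrow> 0"
  proof (rule Lim_null_comparison)
    show "\<forall>\<^sub>F k in sequentially. norm (e (s k) *\<^sub>R push (e (s k)) (z (s k))) \<le> e (s k) * B"
      using small[OF z] by simp
    show "(\<lambda>k. e (s k) * B) \<longlonglongrightarrow> 0" using tendsto_mult_right[OF le, of B] by simp
  qed
  from tendsto_add[OF lz this] have "(\<lambda>k. z (s k) + e (s k) *\<^sub>R push (e (s k)) (z (s k))) \<longlonglongrightarrow> z0" by simp
  then have "(\<lambda>k. y (s k)) \<longlonglongrightarrow> normalize_time z0"
    unfolding y_def using fut[OF z] fundamental_future[OF z0]
    by (intro continuous_on_tendsto_compose[OF continuous_on_normalize_time]) auto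
  moreover have "normalize_time z0 = z0"
    using normalize_time_scale[of z0 1] z0 by (simp add: fundamental_def)
  ultimately have ly: "(\<lambda>k. blinfun_apply (w' (s k)) (u (s k))) \<longlonglongrightarrow> z0" by (simp add: w'(2))
  have ev1: "\<forall>\<^sub>F k in sequentially. blinfun_apply (w' (s k)) x0 = z0"
    using w'(1) uH lu' ly by (intro eventually_apply_limit[where x = "\<lambda>k. u (s k)"]) auto
  have ev2: "\<forall>\<^sub>F k in sequentially. blinfun_apply (w (s k)) z0 = g x0"
    using w(1) zH lz lg by (intro eventually_apply_limit[where x = "\<lambda>k. z (s k)"]) (auto simp: w(2))
  \<comment> \<open>Walls not through \<open>z0\<close> are eventually out of the range e of the
    push, so only normals of walls through \<open>z0\<close> occur in it. This is what makes c
    orthogonal to \<open>x0\<close>.\<close>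
  have ev3: "\<forall>\<^sub>F k in sequentially. \<forall>a\<in>wall_roots. mink z0 a > 0 \<longrightarrow> mink (z (s k)) a > e (s k)"
  proof (intro eventually_ball_finite finite_wall_roots ballI)
    fix a
    show "\<forall>\<^sub>F k in sequentially. mink z0 a > 0 \<longrightarrow> mink (z (s k)) a > e (s k)"
    proof (cases "mink z0 a > 0")
      case True
      have "(\<lambda>k. mink (z (s k)) a - e (s k)) \<longlonglongrightarrow> mink z0 a - 0"
        by (intro tendsto_diff mink.tendsto lz le tendsto_const)
      then have "\<forall>\<^sub>F k in sequentially. 0 < mink (z (s k)) a - e (s k)"
        using True by (intro order_tendstoD(1)) auto
      then show ?thesis by (rule eventually_mono) simp
    qed simp
  qed
  from eventually_conj[OF ev1 eventually_conj[OF ev2 ev3]] obtain m where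
    m: "blinfun_apply (w' (s m)) x0 = z0" "blinfun_apply (w (s m)) z0 = g x0"
      "\<And>a. a \<in> wall_roots \<Longrightarrow> mink z0 a > 0 \<Longrightarrow> mink (z (s m)) a > e (s m)"
    unfolding eventually_sequentially by blast
  have z0x0: "z0 = x0" using fundamental_unique[OF w'(1) x0, of "s m"] z0 m(1) by simp
  define \<epsilon> U Z c where "\<epsilon> = e (s m)" and "U = u (s m)" and "Z = z (s m)" and "c = push \<epsilon> Z"
  have \<epsilon>: "\<epsilon> > 0" using e by (simp add: \<epsilon>_def)
  have U: "U \<in> fundamental" and Z: "Z \<in> fundamental" using u(1) z by (simp_all add: U_def Z_def)
  have Zpos: "mink Z a \<ge> 0" if "a \<in> wall_roots" for a
    using that Z by (simp add: wall_roots_def fundamental_def closed_chamber_def)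
  have "Z + \<epsilon> *\<^sub>R c \<in> future_cone" using fut[OF z] by (simp add: \<epsilon>_def c_def Z_def)
  then obtain l where l: "l > 0" "Z + \<epsilon> *\<^sub>R c = l *\<^sub>R y (s m)"
    using future_cone_normalize unfolding y_def \<epsilon>_def c_def Z_def by blast
  then have eq: "Z + \<epsilon> *\<^sub>R c = l *\<^sub>R blinfun_apply (w' (s m)) U" using w'(2)[of "s m"] by (simp add: U_def)
  have cx0: "mink x0 c = 0"
    unfolding c_def mink_push
  proof (intro sum.neutral ballI)
    fix a assume a: "a \<in> wall_roots"
    then have "mink x0 a \<ge> 0" using x0 by (simp add: wall_roots_def fundamental_def closed_chamber_def)
    then show "max 0 (\<epsilon> - mink Z a) * mink x0 a = 0"
      using m(3)[OF a] by (cases "mink x0 a = 0") (auto simp: z0x0 \<epsilon>_def Z_def)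
  qed
  \<comment> \<open>The element \<open>w (s m)\<close> sends Z to g U and x0 to g x0, so here g
    being an isometry enters.\<close>
  have "mink Z x0 = mink U x0"
  proof -
    have "mink Z x0 = mink (blinfun_apply (w (s m)) Z) (blinfun_apply (w (s m)) x0)"
      using w(1) by (simp add: mink_apply)
    also have "\<dots> = mink (g U) (g x0)" using w(2) m(2) by (simp add: Z_def U_def z0x0)
    finally show ?thesis by (simp add: iso)
  qed
  moreover have "mink (blinfun_apply (w' (s m)) U) x0 = mink U x0"
    using mink_apply[OF w'(1), of "s m" U x0] m(1) by (simp add: z0x0)
  moreover have "mink Z x0 = l * mink (blinfun_apply (w' (s m)) U) x0"
    using arg_cong[OF eq, of "\<lambda>v. mink v x0"] cx0 by (simp add: mink_linear mink_commute[of c x0])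
  moreover have "mink U x0 < 0" using U x0 by (intro mink_future fundamental_future)
  ultimately have "l = 1" by simp
  have UU: "mink U U = -1" and ZZ: "mink Z Z = -1" using U Z by (simp_all add: fundamental_def hyperbolic_mink)
  have "mink (Z + \<epsilon> *\<^sub>R c) (Z + \<epsilon> *\<^sub>R c) = -1"
    unfolding eq using \<open>l = 1\<close> w'(1) UU by (simp add: mink_apply)
  then have "\<epsilon> * (2 * mink Z c + \<epsilon> * mink c c) = 0"
    using ZZ by (simp add: mink_linear mink_commute[of c Z] algebra_simps)
  then have norms: "2 * mink Z c + \<epsilon> * mink c c = 0" using \<epsilon> by simp
  have "mink Z c \<ge> 0"
    unfolding c_def mink_push using Zpos by (intro sum_nonneg mult_nonneg_nonneg) auto
  then have "mink c c \<le> 0" using norms \<epsilon> mult_pos_pos[of \<epsilon> "mink c c"] by linarith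
  then have "c = 0"
    using orthogonal_timelike[OF _ cx0] x0H hyperbolic_mink[of x0] by force
  \<comment> \<open>The base point p is positive on all wall roots, so pairing c = 0 with p leaves a
    vanishing sum of nonnegative terms, and every coefficient is zero.\<close>
  have far: "mink Z a \<ge> \<epsilon>" if a: "a \<in> wall_roots" for a
  proof (rule ccontr)
    assume "\<not> mink Z a \<ge> \<epsilon>"
    then have "max 0 (\<epsilon> - mink Z a) * mink p a > 0"
      using a by (simp add: wall_roots_def pos_def)
    then have "mink p c > 0"
      unfolding c_def mink_push using a
      by (intro sum_pos2[OF finite_wall_roots a]) (auto simp: wall_roots_def pos_def)
    with \<open>c = 0\<close> show False by (simp add: mink_linear)
  qed
  have "Z \<in> open_chamber"
    unfolding open_chamber_def
  proof (intro CollectI conjI ballI fundamental_future[OF Z])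
    fix a assume a: "a \<in> pos"
    show "mink Z a > 0"
    proof (cases "a \<in> wall_roots")
      case True
      then show ?thesis using far[OF True] \<epsilon> by simp
    next
      case False
      then have "mink Z a \<noteq> 0" using a Z by (auto simp: wall_roots_def)
      moreover have "mink Z a \<ge> 0" using a Z by (simp add: fundamental_def closed_chamber_def)
      ultimately show ?thesis by simp
    qed
  qed
  have "Z = blinfun_apply (w' (s m)) U" using eq \<open>l = 1\<close> \<open>c = 0\<close> by simp
  then have "Z = U" using fundamental_unique[OF w'(1) U, of "s m"] Z by simp
  then have "g U = blinfun_apply (w (s m)) U" using w(2)[of "s m"] by (simp add: U_def Z_def)
  then show ?thesis using that[of "w (s m)" U] w(1) \<open>Z \<in> open_chamber\<close> \<open>Z = U\<close> U by (simp add: fundamental_def)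
qed

end

section \<open>The tilings\<close>

context compact_chamber
begin

abbreviation closed_cone where "closed_cone \<equiv> insert 0 closed_chamber"

lemma dual_cone_interior_pos:
  assumes y: "y \<in> dual_cone closed_cone" "y \<noteq> 0" and x: "x \<in> open_chamber"
  shows "mink y x > 0"
proof -
  have ge: "mink y z \<ge> 0" if "z \<in> open_chamber" for z
    using y(1) that open_subset_closed by (auto simp: dual_cone_def)
  have "mink y x \<noteq> 0"
  proof
    assume "mink y x = 0"
    then have "- y = 0"
      using mink_open_zero[OF open_open_chamber x, of "- y"] ge by (simp add: mink_linear)
    with y(2) show False by simp
  qed
  with ge[OF x] show ?thesis by simp
qed

text \<open>Membership in the dual cone is the Dirichlet inequality. The square of x - w x is 2
  ([x, x] - [w x, x]), so it is nonpositive only in the equality case w x = x, and the zero vector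
  belongs to \<open>K_plus\<close>.\<close>

lemma diff_image_subset:
  assumes w: "w \<in> W" and x: "x \<in> open_chamber"
  shows "x - blinfun_apply w x \<in> dual_cone closed_cone - K_minus"
proof
  have xc: "x \<in> closed_chamber" using x open_subset_closed by blast
  show "x - blinfun_apply w x \<in> dual_cone closed_cone"
    using mink_apply_le[OF w xc] by (simp add: dual_cone_def mink_linear del: split_paired_All)
  show "x - blinfun_apply w x \<notin> K_minus"
  proof
    assume k: "x - blinfun_apply w x \<in> K_minus"
    then have "mink (x - blinfun_apply w x) (x - blinfun_apply w x) \<le> 0"
      by (simp add: K_minus_def K_cone_def)
    then have "mink (blinfun_apply w x) x \<ge> mink x x"
      using w by (simp add: mink_linear mink_apply mink_commute[of x "blinfun_apply w x"])
    then have "mink (blinfun_apply w x) x = mink x x" using mink_apply_le[OF w xc xc] by simp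
    then have "blinfun_apply w x = x" using mink_apply_eq[OF w xc x] by simp
    with k show False by (simp add: K_minus_def K_cone_def K_plus_def mink_linear)
  qed
qed

text \<open>If y is nonzero and not spacelike it is future causal and pairs negatively with p,
  contradicting the dual cone. For spacelike y, the interior u with reflect b u = w u has u - w u
  proportional to y. The factor is positive as [y, u] > 0, and the chamber is a cone, so rescaling u
  reaches y itself.\<close>

lemma diff_image_exists:
  assumes y: "y \<in> dual_cone closed_cone" "y \<notin> K_minus"
  obtains w x where "w \<in> W" "x \<in> open_chamber" "y = x - blinfun_apply w x"
proof (cases "y = 0")
  case True
  then show ?thesis using that[OF id_in base_open_chamber] by simp
next
  case False
  have "mink y y > 0"
  proof (rule ccontr)
    assume n: "\<not> mink y y > 0"
    then have "fst y \<ge> 0" using y(2) by (simp add: K_minus_def K_cone_def K_plus_def)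
    then have "mink p y < 0" using n False by (intro mink_future_causal hyperbolic_future[OF base]) auto
    with dual_cone_interior_pos[OF y(1) False base_open_chamber] show False
      by (simp add: mink_commute[of p y])
  qed
  define s where "s = sqrt (mink y y)"
  have s: "s > 0" "s * s = mink y y" using \<open>mink y y > 0\<close> by (simp_all add: s_def)
  define b where "b = (1 / s) *\<^sub>R y"
  have yb: "y = s *\<^sub>R b" using s by (simp add: b_def)
  have "mink b b = mink y y / (s * s)" by (simp add: b_def mink_linear)
  then have bb: "mink b b = 1" using s \<open>mink y y > 0\<close> by simp
  have "continuous_on hyperbolic_space (reflect b)"
    unfolding reflect_def by (intro continuous_intros mink.continuous_on)
  moreover have "reflect b ` hyperbolic_space \<subseteq> hyperbolic_space"
    using bb by (intro image_subsetI reflect_hyperbolic)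
  moreover have "mink (reflect b x) (reflect b x') = mink x x'" for x x' using bb by (rule mink_reflect)
  ultimately obtain w u where w: "w \<in> W" and u: "u \<in> open_chamber" and eq: "reflect b u = blinfun_apply w u"
    by (rule interior_fixed_point) blast
  have "mink y u > 0" using dual_cone_interior_pos[OF y(1) False u] .
  then have "s * mink u b > 0" unfolding yb by (simp add: mink_linear mink_commute[of b u])
  then have ub: "mink u b > 0" using s(1) by (simp add: zero_less_mult_iff)
  define t where "t = s / (2 * mink u b)"
  have t: "t > 0" using s(1) ub by (simp add: t_def)
  have "u - blinfun_apply w u = (2 * mink u b) *\<^sub>R b" unfolding eq[symmetric] by (simp add: reflect_def)
  then have "t *\<^sub>R (u - blinfun_apply w u) = y" using ub by (simp add: t_def yb)
  then have "y = t *\<^sub>R u - blinfun_apply w (t *\<^sub>R u)" by (simp add: blinfun.scaleR_right scaleR_diff_right)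
  then show ?thesis using that[OF w open_chamber_scale[OF u t]] by blast
qed

theorem dual_cone_tiling:
  "dual_cone closed_cone - K_minus = (\<Union>w\<in>W. (\<lambda>x. x - blinfun_apply w x) ` open_chamber)"
proof
  show "dual_cone closed_cone - K_minus \<subseteq> (\<Union>w\<in>W. (\<lambda>x. x - blinfun_apply w x) ` open_chamber)"
  proof
    fix y assume "y \<in> dual_cone closed_cone - K_minus"
    then obtain w x where "w \<in> W" "x \<in> open_chamber" "y = x - blinfun_apply w x"
      using diff_image_exists by blast
    then show "y \<in> (\<Union>w\<in>W. (\<lambda>x. x - blinfun_apply w x) ` open_chamber)" by blast
  qed
  show "(\<Union>w\<in>W. (\<lambda>x. x - blinfun_apply w x) ` open_chamber) \<subseteq> dual_cone closed_cone - K_minus"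
    using diff_image_subset by blast
qed

text \<open>A common displacement y satisfies 2 [x, y] = [y, y] = 2 [x', y], so expanding
  [x - y, x' - y] gives [x, x'], the hypothesis of \<open>group_element_unique\<close>.\<close>

theorem dual_cone_tiling_disjoint:
  "disjoint_family_on (\<lambda>w. (\<lambda>x. x - blinfun_apply w x) ` open_chamber) W"
  unfolding disjoint_family_on_def
proof (intro ballI impI)
  fix w w' assume w: "w \<in> W" "w' \<in> W" "w \<noteq> w'"
  have False if x: "x \<in> open_chamber" "x' \<in> open_chamber"
    and eq: "x - blinfun_apply w x = x' - blinfun_apply w' x'" for x x'
  proof -
    define y where "y = x - blinfun_apply w x"
    have e: "blinfun_apply w x = x - y" "blinfun_apply w' x' = x' - y"
      by (simp add: y_def) (simp add: y_def eq)
    have "2 * mink x y = mink y y"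
      using mink_apply[OF w(1), of x x] unfolding e by (simp add: mink_linear mink_commute[of y x])
    moreover have "2 * mink x' y = mink y y"
      using mink_apply[OF w(2), of x' x'] unfolding e by (simp add: mink_linear mink_commute[of y x'])
    ultimately have "mink (blinfun_apply w x) (blinfun_apply w' x') = mink x x'"
      unfolding e by (simp add: mink_linear mink_commute[of y x'])
    with group_element_unique[OF w(1,2) x] w(3) show False by blast
  qed
  then show "(\<lambda>x. x - blinfun_apply w x) ` open_chamber \<inter> (\<lambda>x. x - blinfun_apply w' x) ` open_chamber = {}"
    by blast
qed

section \<open>The tiling of the interior of \<open>K_minus\<close>\<close>

lemma past_image_exists:
  assumes q: "q \<in> future_cone"
  obtains w x where "w \<in> W" "x \<in> open_chamber" "q = x + blinfun_apply w x"
proof -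
  define h where "h = normalize_time q"
  obtain s where s: "s > 0" and h: "h \<in> hyperbolic_space" and qh: "q = s *\<^sub>R h"
    using future_cone_normalize[OF q] unfolding h_def by blast
  \<comment> \<open>The point reflection in h: it fixes h, since [h, h] = -1, and negates the
    orthogonal complement of h. It keeps the upper sheet because [x, h]^2 \<ge> 1 makes [x, g x]
    negative.\<close>
  define g where "g x = - x - (2 * mink x h) *\<^sub>R h" for x
  have gg: "mink (g x) (g x') = mink x x'" for x x'
    using hyperbolic_mink[OF h] by (simp add: g_def mink_linear mink_commute[of h x'])
  have "g x \<in> hyperbolic_space" if x: "x \<in> hyperbolic_space" for x
  proof -
    have "mink x (g x) = 1 - 2 * (mink x h)\<^sup>2"
      using x by (simp add: g_def mink_linear power2_eq_square hyperbolic_mink)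
    moreover have "(mink x h)\<^sup>2 \<ge> 1"
      using mink_hyperbolic_le[OF x h] abs_le_square_iff[of 1 "mink x h"] by simp
    ultimately have "mink x (g x) < 0" by linarith
    then have "g x \<in> future_cone"
      using x by (intro timelike_future[OF hyperbolic_future[OF x]]) (simp_all add: gg hyperbolic_mink)
    then show ?thesis using gg[of x x] x by (simp add: hyperbolic_space_def future_cone_def)
  qed
  then have "g ` hyperbolic_space \<subseteq> hyperbolic_space" by blast
  moreover have "continuous_on hyperbolic_space g"
    unfolding g_def by (intro continuous_intros mink.continuous_on)
  ultimately obtain w u where w: "w \<in> W" and u: "u \<in> open_chamber" and eq: "g u = blinfun_apply w u"
    using gg interior_fixed_point[of g] by blast
  have uh: "mink u h < 0" using u h by (intro mink_future chamber_future hyperbolic_future)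
  define t where "t = s / (- (2 * mink u h))"
  have t: "t > 0" using s uh unfolding t_def by (intro divide_pos_pos) auto
  have "u + blinfun_apply w u = (- (2 * mink u h)) *\<^sub>R h" unfolding eq[symmetric] by (simp add: g_def)
  then have "t *\<^sub>R (u + blinfun_apply w u) = q" using uh by (simp add: t_def qh)
  then have "q = t *\<^sub>R u + blinfun_apply w (t *\<^sub>R u)" by (simp add: blinfun.scaleR_right scaleR_add_right)
  then show ?thesis using that[OF w open_chamber_scale[OF u t]] by blast
qed

theorem past_cone_tiling:
  "uminus ` future_cone = (\<Union>w\<in>W. (\<lambda>x. - x - blinfun_apply w x) ` open_chamber)"
proof
  show "uminus ` future_cone \<subseteq> (\<Union>w\<in>W. (\<lambda>x. - x - blinfun_apply w x) ` open_chamber)"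
  proof
    fix y assume "y \<in> uminus ` (future_cone :: 'n minkowski set)"
    then obtain q where q: "q \<in> future_cone" "y = - q" by blast
    obtain w x where wx: "w \<in> W" "x \<in> open_chamber" "q = x + blinfun_apply w x"
      by (rule past_image_exists[OF q(1)]) blast
    then have "y = - x - blinfun_apply w x" using q(2) by simp
    then show "y \<in> (\<Union>w\<in>W. (\<lambda>x. - x - blinfun_apply w x) ` open_chamber)" using wx by blast
  qed
  show "(\<Union>w\<in>W. (\<lambda>x. - x - blinfun_apply w x) ` open_chamber) \<subseteq> uminus ` future_cone"
  proof (intro UN_least image_subsetI)
    fix w x assume w: "w \<in> W" and x: "x \<in> open_chamber"
    have "x + blinfun_apply w x \<in> future_cone"
      using w x by (intro future_cone_add future_apply chamber_future)
    moreover have "- x - blinfun_apply w x = - (x + blinfun_apply w x)" by simp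
    ultimately show "- x - blinfun_apply w x \<in> uminus ` future_cone" by blast
  qed
qed

text \<open>As for the differences, with the sign changed: both points satisfy 2 [x, y] = -[y, y],
  and the cross terms cancel in [x + y, x' + y].\<close>

theorem past_cone_tiling_disjoint:
  "disjoint_family_on (\<lambda>w. (\<lambda>x. - x - blinfun_apply w x) ` open_chamber) W"
  unfolding disjoint_family_on_def
proof (intro ballI impI)
  fix w w' assume w: "w \<in> W" "w' \<in> W" "w \<noteq> w'"
  have False if x: "x \<in> open_chamber" "x' \<in> open_chamber"
    and eq: "- x - blinfun_apply w x = - x' - blinfun_apply w' x'" for x x'
  proof -
    define y where "y = - x - blinfun_apply w x"
    have e: "blinfun_apply w x = - x - y" "blinfun_apply w' x' = - x' - y"
      by (simp add: y_def) (simp add: y_def eq)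
    have "2 * mink x y = - mink y y"
      using mink_apply[OF w(1), of x x] unfolding e by (simp add: mink_linear mink_commute[of y x])
    moreover have "2 * mink x' y = - mink y y"
      using mink_apply[OF w(2), of x' x'] unfolding e by (simp add: mink_linear mink_commute[of y x'])
    ultimately have "mink (blinfun_apply w x) (blinfun_apply w' x') = mink x x'"
      unfolding e by (simp add: mink_linear mink_commute[of y x'])
    with group_element_unique[OF w(1,2) x] w(3) show False by blast
  qed
  then show "(\<lambda>x. - x - blinfun_apply w x) ` open_chamber \<inter> (\<lambda>x. - x - blinfun_apply w' x) ` open_chamber = {}"
    by blast
qed

section \<open>The cone over D and the interiors of the two cones\<close>

lemma fundamental_cone_hull: "cone hull fundamental = closed_cone"
proof
  show "cone hull fundamental \<subseteq> closed_cone"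
  proof
    fix x assume "x \<in> cone hull fundamental"
    then obtain c z where c: "c \<ge> 0" "z \<in> fundamental" "x = c *\<^sub>R z" by (auto simp: cone_hull_expl)
    then show "x \<in> closed_cone" using closed_chamber_scale[of z c]
      by (cases "c = 0") (auto simp: fundamental_def)
  qed
  show "closed_cone \<subseteq> cone hull fundamental"
  proof
    fix x assume x: "x \<in> closed_cone"
    show "x \<in> cone hull fundamental"
    proof (cases "x = 0")
      case True
      obtain z where "z \<in> fundamental" using fundamental_nonempty by blast
      then have "0 *\<^sub>R z \<in> cone hull fundamental" unfolding cone_hull_expl by blast
      then show ?thesis using True by simp
    next
      case False
      with x have xc: "x \<in> closed_chamber" by simp
      obtain t where t: "t > 0" "normalize_time x \<in> hyperbolic_space" "x = t *\<^sub>R normalize_time x"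
        by (rule future_cone_normalize[OF chamber_future(1)[OF xc]])
      have "normalize_time x \<in> fundamental"
        using t(2) chamber_normalize(2)[OF xc] by (simp add: fundamental_def)
      then have "t *\<^sub>R normalize_time x \<in> cone hull fundamental"
        unfolding cone_hull_expl using less_imp_le[OF t(1)] by blast
      then show ?thesis using t(3) by simp
    qed
  qed
qed

text \<open>From an interior point one can move a little in every direction. Moving along -p
  excludes the apex, and moving along -a lowers the product with a unit root a by the full step, so
  it was strictly positive.\<close>

lemma interior_closed_cone: "interior closed_cone = open_chamber"
proof
  show "open_chamber \<subseteq> interior closed_cone"
    using open_subset_closed by (intro interior_maximal open_open_chamber) blast
  show "interior closed_cone \<subseteq> open_chamber"
  proof
    fix x assume "x \<in> interior closed_cone"
    then obtain e where e: "e > 0" "cball x e \<subseteq> closed_cone" unfolding mem_interior_cball by blast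
    then have xin: "x \<in> closed_cone" by (meson centre_in_cball less_imp_le subsetD)
    have move: "\<exists>t>0. x - t *\<^sub>R v \<in> closed_cone" for v
    proof (cases "v = 0")
      case True
      then show ?thesis using xin by (intro exI[of _ 1]) auto
    next
      case False
      then have "x - (e / norm v) *\<^sub>R v \<in> cball x e" using e by (simp add: dist_norm)
      then have "x - (e / norm v) *\<^sub>R v \<in> closed_cone" using e(2) by blast
      then show ?thesis using False e(1) by (intro exI[of _ "e / norm v"]) simp
    qed
    have fst_nonneg: "fst z \<ge> 0" if "z \<in> closed_cone" for z
      using that by (auto simp: closed_chamber_def future_cone_def)
    have "x \<noteq> 0"
    proof
      assume "x = 0"
      then obtain t where "t > 0" "fst (- (t *\<^sub>R p)) \<ge> 0"
        using move[of p] fst_nonneg by (metis diff_0)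
      moreover have "fst p > 0" using base by (simp add: hyperbolic_space_def)
      ultimately show False by (simp add: mult_le_0_iff)
    qed
    with xin have xc: "x \<in> closed_chamber" by simp
    have "mink x a > 0" if a: "a \<in> pos" for a
    proof -
      obtain t where t: "t > 0" "x - t *\<^sub>R a \<in> closed_cone" using move by blast
      then have "mink (x - t *\<^sub>R a) a \<ge> 0" using a by (auto simp: closed_chamber_def mink_linear)
      then show ?thesis using t(1) root_unit[OF pos_root[OF a]] by (simp add: mink_linear)
    qed
    then show "x \<in> open_chamber" using xc by (simp add: open_chamber_def closed_chamber_def)
  qed
qed

end

lemma interior_K_minus: "interior K_minus = uminus ` (future_cone :: 'n::finite minkowski set)"
proof
  have eq: "uminus ` (future_cone :: 'n minkowski set) = {x. mink x x < 0 \<and> fst x < 0}"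
  proof
    show "{x :: 'n minkowski. mink x x < 0 \<and> fst x < 0} \<subseteq> uminus ` future_cone"
    proof
      fix x :: "'n minkowski" assume "x \<in> {x. mink x x < 0 \<and> fst x < 0}"
      then have "- x \<in> future_cone" by (simp add: future_cone_def mink_linear)
      then show "x \<in> uminus ` future_cone" by (metis imageI minus_minus)
    qed
    show "uminus ` future_cone \<subseteq> {x :: 'n minkowski. mink x x < 0 \<and> fst x < 0}"
      by (intro image_subsetI) (simp add: future_cone_def mink_linear)
  qed
  show "uminus ` (future_cone :: 'n minkowski set) \<subseteq> interior K_minus"
  proof (rule interior_maximal)
    show "open (uminus ` (future_cone :: 'n minkowski set))"
      using open_future_cone by (rule open_negations)
  qed (auto simp: eq K_minus_def K_cone_def K_plus_def)
  show "interior K_minus \<subseteq> uminus ` (future_cone :: 'n minkowski set)"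
  proof
    fix x :: "'n minkowski" assume x: "x \<in> interior K_minus"
    then obtain e where e: "e > 0" "cball x e \<subseteq> K_minus" unfolding mem_interior_cball by blast
    have k: "mink x x \<le> 0" "fst x < 0"
      using x interior_subset[of K_minus] by (auto simp: K_minus_def K_cone_def K_plus_def)
    \<comment> \<open>Raising the time coordinate by d stays in the ball and, as d \<le> -x_0, adds
      the positive amount d (-2 x_0 - d) to [x, x]. The sum is still nonpositive, which excludes
      lightlike x.\<close>
    define d where "d = min e (- fst x)"
    have d: "d > 0" "d \<le> e" "d \<le> - fst x" using e k by (auto simp: d_def)
    have "x + (d, 0) \<in> cball x e" using d by (simp add: dist_norm norm_prod_def)
    then have "mink (x + (d, 0)) (x + (d, 0)) \<le> 0" using e by (auto simp: K_minus_def K_cone_def)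
    moreover have "mink (x + (d, 0)) (x + (d, 0)) = mink x x + d * (- 2 * fst x - d)"
      by (simp add: mink_eq_inner algebra_simps)
    moreover have "d * (- 2 * fst x - d) > 0" using d k by (intro mult_pos_pos) auto
    ultimately show "x \<in> uminus ` future_cone" unfolding eq using k by simp
  qed
qed

section \<open>Discrete reflection groups in the isometry group\<close>

lemma reflection_along_unit:
  assumes "reflection_along a s"
  obtains b where "mink b b = 1" "\<And>x. blinfun_apply s x = reflect b x" "hyp_hyperplane b = hyp_hyperplane a"
proof
  define n where "n = sqrt (mink a a)"
  have pa: "mink a a > 0" and s: "\<And>x. blinfun_apply s x = x - (2 * mink x a / mink a a) *\<^sub>R a"
    using assms unfolding reflection_along_def by blast+
  have n: "n > 0" "n * n = mink a a" using pa by (simp_all add: n_def)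
  have "mink ((1 / n) *\<^sub>R a) ((1 / n) *\<^sub>R a) = mink a a / (n * n)" by (simp add: mink_linear)
  then show "mink ((1 / n) *\<^sub>R a) ((1 / n) *\<^sub>R a) = 1" using n pa by simp
  show "blinfun_apply s x = reflect ((1 / n) *\<^sub>R a) x" for x
    unfolding s reflect_def by (simp add: mink_linear n(2)[symmetric])
  show "hyp_hyperplane ((1 / n) *\<^sub>R a) = hyp_hyperplane a"
    using n by (simp add: hyp_hyperplane_def mink_linear)
qed

lemma monoid_isometry_group:
  "monoid (isometry_group :: ('n::finite minkowski \<Rightarrow>\<^sub>L 'n minkowski) monoid)"
proof
  fix f g :: "'n minkowski \<Rightarrow>\<^sub>L 'n minkowski"
  assume "f \<in> carrier isometry_group" "g \<in> carrier isometry_group"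
  then show "f \<otimes>\<^bsub>isometry_group\<^esub> g \<in> carrier isometry_group"
    by (simp add: isometry_group_def image_comp[symmetric] image_image[symmetric] del: split_paired_All)
qed (auto simp: isometry_group_def intro!: blinfun_eqI)

lemma reflection_group_if_discrete:
  fixes W :: "('n::finite minkowski \<Rightarrow>\<^sub>L 'n minkowski) set"
  assumes W: "discrete_reflection_group W"
  shows "reflection_group W"
proof -
  from W obtain S where dW: "discrete W" and S: "\<And>s. s \<in> S \<Longrightarrow> \<exists>a. reflection_along a s"
    and WS: "W = generate isometry_group S"
    unfolding discrete_reflection_group_def by blast
  interpret monoid "isometry_group :: ('n minkowski \<Rightarrow>\<^sub>L 'n minkowski) monoid" by (rule monoid_isometry_group)
  have refl: "\<exists>b. mink b b = 1 \<and> (\<forall>x. blinfun_apply s x = reflect b x)" if "s \<in> S" for s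
    using S[OF that] by (metis reflection_along_unit)
  have self_inv: "s o\<^sub>L s = id_blinfun" if "s \<in> S" for s
  proof -
    from refl[OF that] obtain b where "mink b b = 1" "\<forall>x. blinfun_apply s x = reflect b x" by blast
    then show ?thesis by (intro blinfun_eqI) (simp del: split_paired_All)
  qed
  \<comment> \<open>In \<open>generate\<close>, inverses occur only at generators. Reflections are
    involutions, so uniqueness of inverses in the monoid identifies \<open>inv\<close> with the
    generator itself.\<close>
  have inv: "inv\<^bsub>isometry_group\<^esub> s = s" if s: "s \<in> S" for s
  proof -
    from refl[OF s] obtain b where b: "mink b b = 1" "\<And>x. blinfun_apply s x = reflect b x" by blast
    have sub: "blinfun_apply s ` hyperbolic_space \<subseteq> hyperbolic_space"
      using b by (auto intro: reflect_hyperbolic)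
    moreover have "hyperbolic_space \<subseteq> blinfun_apply s ` hyperbolic_space"
    proof
      fix x :: "'n minkowski" assume x: "x \<in> hyperbolic_space"
      have "x = blinfun_apply s (blinfun_apply s x)" using b by simp
      then show "x \<in> blinfun_apply s ` hyperbolic_space" using sub x by blast
    qed
    ultimately have "s \<in> carrier isometry_group"
      using b by (auto simp: isometry_group_def mink_reflect)
    moreover have "s \<otimes>\<^bsub>isometry_group\<^esub> s = \<one>\<^bsub>isometry_group\<^esub>"
      using self_inv[OF s] by (simp add: isometry_group_def)
    ultimately show ?thesis using inv_unique'[of s s] by simp
  qed
  have one: "id_blinfun \<in> W" using generate.one[of isometry_group S] by (simp add: WS isometry_group_def)
  have mult: "u o\<^sub>L v \<in> W" if "u \<in> W" "v \<in> W" for u v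
    using generate.eng[of u isometry_group S v] that by (simp add: WS isometry_group_def)
  have SW: "S \<subseteq> W" unfolding WS by (blast intro: generate.incl)
  \<comment> \<open>The locale constant \<open>roots\<close> is available only once
    \<open>lorentz_group W\<close> is established, so its defining condition is spelled out
    here.\<close>
  have word: "\<exists>as. (\<forall>a\<in>set as. mink a a = 1 \<and> (\<exists>s\<in>W. \<forall>x. blinfun_apply s x = reflect a x)) \<and>
    (\<forall>x. blinfun_apply w x = word as x)" (is "\<exists>as. ?P as w") if "w \<in> W" for w
    using that unfolding WS
  proof (induction rule: generate.induct)
    case one
    have "?P [] (\<one>\<^bsub>isometry_group\<^esub>)" by (simp add: isometry_group_def)
    then show ?case unfolding WS by blast
  next
    case (incl s)
    from refl[OF incl] obtain b where "mink b b = 1" "\<And>x. blinfun_apply s x = reflect b x" by blast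
    then have "?P [b] s" using SW incl by auto
    then show ?case unfolding WS by blast
  next
    case (inv s)
    from refl[OF inv] obtain b where "mink b b = 1" "\<And>x. blinfun_apply s x = reflect b x" by blast
    then have "?P [b] s" using SW inv by auto
    then show ?case unfolding WS \<open>\<And>s. s \<in> S \<Longrightarrow> inv\<^bsub>isometry_group\<^esub> s = s\<close>[OF inv] by blast
  next
    case (eng u v)
    then obtain as bs where "?P as u" "?P bs v" unfolding WS by blast
    then have "?P (as @ bs) (u \<otimes>\<^bsub>isometry_group\<^esub> v)" by (auto simp: isometry_group_def word_append simp del: split_paired_All)
    then show ?case unfolding WS by blast
  qed
  have word_mink: "mink (word as x) (word as y) = mink x y" if "\<forall>a\<in>set as. mink a a = 1" for as and x y :: "'n minkowski"
    using that by (induction as) (auto simp: mink_reflect)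
  have word_hyp: "word as x \<in> hyperbolic_space"
    if "\<forall>a\<in>set as. mink a a = 1" "x \<in> hyperbolic_space" for as and x :: "'n minkowski"
    using that by (induction as) (auto simp: reflect_hyperbolic)
  have inverse: "\<exists>v\<in>W. v o\<^sub>L w = id_blinfun \<and> w o\<^sub>L v = id_blinfun" if "w \<in> W" for w
  proof -
    from that[unfolded WS] show ?thesis
    proof (induction rule: generate.induct)
      case one
      show ?case using \<open>id_blinfun \<in> W\<close> by (intro bexI[of _ id_blinfun]) (auto simp: isometry_group_def intro: blinfun_eqI)
    next
      case (incl s)
      then show ?case using SW self_inv by blast
    next
      case (inv s)
      then show ?case using SW self_inv \<open>\<And>s. s \<in> S \<Longrightarrow> inv\<^bsub>isometry_group\<^esub> s = s\<close> by auto
    next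
      case (eng u v)
      then obtain u' v' where uv: "u' \<in> W" "u' o\<^sub>L u = id_blinfun" "u o\<^sub>L u' = id_blinfun"
        "v' \<in> W" "v' o\<^sub>L v = id_blinfun" "v o\<^sub>L v' = id_blinfun" by blast
      have "blinfun_apply u' (blinfun_apply u x) = x" "blinfun_apply u (blinfun_apply u' x) = x"
        "blinfun_apply v' (blinfun_apply v x) = x" "blinfun_apply v (blinfun_apply v' x) = x" for x
        using uv by (metis blinfun_apply_blinfun_compose id_blinfun.rep_eq id_apply)+
      then have "(v' o\<^sub>L u') o\<^sub>L (u o\<^sub>L v) = id_blinfun" "(u o\<^sub>L v) o\<^sub>L (v' o\<^sub>L u') = id_blinfun"
        by (simp_all add: blinfun_eqI del: split_paired_All)
      moreover have "u \<otimes>\<^bsub>isometry_group\<^esub> v = u o\<^sub>L v" by (simp add: isometry_group_def)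
      ultimately show ?case using mult[OF uv(4,1)] by metis
    qed
  qed
  have lorentz: "lorentz_group W"
  proof
    show "mink (blinfun_apply w x) (blinfun_apply w y) = mink x y" if "w \<in> W" for w x y
      using word[OF that] word_mink by metis
    show "blinfun_apply w x \<in> hyperbolic_space" if "w \<in> W" "x \<in> hyperbolic_space" for w x
      using word[OF that(1)] word_hyp that(2) by metis
  qed (use one mult inverse dW in blast)+
  show ?thesis
  proof (intro reflection_group.intro reflection_group_axioms.intro lorentz)
    fix w assume "w \<in> W"
    from word[OF this] show "\<exists>as. set as \<subseteq> lorentz_group.roots W \<and> (\<forall>x. blinfun_apply w x = word as x)"
      unfolding lorentz_group.roots_def[OF lorentz] by blast
  qed
qed

section \<open>Components of the complement of the mirrors are open chambers\<close>

lemma (in reflection_group) mirror_complement: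
  "hyperbolic_space - \<Union>(mirrors W) = {x \<in> hyperbolic_space. \<forall>a\<in>roots. mink x a \<noteq> 0}"
proof (intro equalityI subsetI)
  fix x assume x: "x \<in> hyperbolic_space - \<Union>(mirrors W)"
  have "mink x a \<noteq> 0" if a: "a \<in> roots" for a
  proof
    assume "mink x a = 0"
    from a obtain s where "s \<in> W" "reflection_along a s"
      by (auto simp: roots_def reflection_along_def reflect_def)
    then have "hyp_hyperplane a \<in> mirrors W" unfolding mirrors_def by blast
    with x \<open>mink x a = 0\<close> show False by (auto simp: hyp_hyperplane_def)
  qed
  with x show "x \<in> {x \<in> hyperbolic_space. \<forall>a\<in>roots. mink x a \<noteq> 0}" by blast
next
  fix x assume x: "x \<in> {x \<in> hyperbolic_space. \<forall>a\<in>roots. mink x a \<noteq> 0}"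
  have "x \<notin> m" if "m \<in> mirrors W" for m
  proof
    assume "x \<in> m"
    from that obtain a s where m: "m = hyp_hyperplane a" "s \<in> W" "reflection_along a s"
      by (auto simp: mirrors_def)
    obtain b where b: "mink b b = 1" "\<And>x. blinfun_apply s x = reflect b x" "hyp_hyperplane b = m"
      using m(1) by (auto intro: reflection_along_unit[OF m(3)])
    then have "b \<in> roots" using m(2) by (auto simp: roots_def)
    then show False using x \<open>x \<in> m\<close> b(3) by (auto simp: hyp_hyperplane_def)
  qed
  with x show "x \<in> hyperbolic_space - \<Union>(mirrors W)" by blast
qed

text \<open>On the connected set U no root vanishes, so each keeps the sign it has at p. Conversely
  the chamber in the hyperboloid is connected, being the continuous image of a convex cone under
  \<open>normalize_time\<close>, and it avoids the mirrors.\<close>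

lemma (in chamber) component_eq:
  assumes U: "U \<in> components (hyperbolic_space - \<Union>(mirrors W))" and p: "p \<in> U"
  shows "U = open_chamber \<inter> hyperbolic_space"
proof
  have sub: "U \<subseteq> {x \<in> hyperbolic_space. \<forall>a\<in>roots. mink x a \<noteq> 0}"
    using in_components_subset[OF U] by (simp add: mirror_complement)
  show "U \<subseteq> open_chamber \<inter> hyperbolic_space"
  proof
    fix x assume x: "x \<in> U"
    then have xH: "x \<in> hyperbolic_space" using sub by blast
    have "mink x a > 0" if a: "a \<in> pos" for a
    proof (rule ccontr)
      assume n: "\<not> mink x a > 0"
      have "connected ((\<lambda>z. mink z a) ` U)"
        using in_components_connected[OF U]
        by (intro connected_continuous_image mink.continuous_on continuous_intros)
      then have "0 \<in> (\<lambda>z. mink z a) ` U"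
      proof (rule connectedD_interval)
        show "mink x a \<in> (\<lambda>z. mink z a) ` U" "mink p a \<in> (\<lambda>z. mink z a) ` U" using x p by blast+
        show "mink x a \<le> 0" "0 \<le> mink p a" using n a by (auto simp: pos_def)
      qed
      then obtain z where "z \<in> U" "mink z a = 0" by (metis imageE)
      with sub pos_root[OF a] show False by blast
    qed
    with xH show "x \<in> open_chamber \<inter> hyperbolic_space" by (simp add: open_chamber_def hyperbolic_future)
  qed
  have "convex open_chamber"
  proof (rule convexI)
    fix x y and u v :: real
    assume *: "x \<in> open_chamber" "y \<in> open_chamber" "0 \<le> u" "0 \<le> v" "u + v = 1"
    show "u *\<^sub>R x + v *\<^sub>R y \<in> open_chamber"
    proof (cases "u = 0 \<or> v = 0")
      case True
      then show ?thesis using * by auto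
    next
      case False
      then have "u *\<^sub>R x \<in> open_chamber" "v *\<^sub>R y \<in> open_chamber"
        using * by (auto intro: open_chamber_scale)
      then show ?thesis using closed_open_add open_subset_closed by blast
    qed
  qed
  then have "connected (normalize_time ` open_chamber)"
    using continuous_on_subset[OF continuous_on_normalize_time] chamber_future(2)
    by (intro connected_continuous_image convex_connected) blast+
  moreover have "normalize_time ` open_chamber = open_chamber \<inter> hyperbolic_space"
  proof
    show "normalize_time ` open_chamber \<subseteq> open_chamber \<inter> hyperbolic_space"
      using chamber_normalize(1) normalize_time_hyperbolic chamber_future(2) by blast
    show "open_chamber \<inter> hyperbolic_space \<subseteq> normalize_time ` open_chamber"
    proof
      fix x assume x: "x \<in> open_chamber \<inter> hyperbolic_space"
      then have "x = normalize_time x" using normalize_time_scale[of x 1] by simp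
      with x show "x \<in> normalize_time ` open_chamber" by blast
    qed
  qed
  moreover have "open_chamber \<inter> hyperbolic_space \<subseteq> hyperbolic_space - \<Union>(mirrors W)"
    using root_open_chamber_ne by (auto simp: mirror_complement)
  ultimately show "open_chamber \<inter> hyperbolic_space \<subseteq> U"
    using p base base_open_chamber by (intro components_maximal[OF U]) (simp_all, blast)
qed

text \<open>Adding a small positive multiple of p moves a point of the closed chamber into the open
  one; normalising returns it to the hyperboloid without changing the limit.\<close>

lemma (in chamber) closure_open_chamber:
  "closure (open_chamber \<inter> hyperbolic_space) = fundamental"
proof
  show "closure (open_chamber \<inter> hyperbolic_space) \<subseteq> fundamental"
    using open_subset_closed by (intro closure_minimal closed_fundamental) (auto simp: fundamental_def)
  show "fundamental \<subseteq> closure (open_chamber \<inter> hyperbolic_space)"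
  proof
    fix x assume x: "x \<in> fundamental"
    then have xf: "x \<in> future_cone" "x \<in> hyperbolic_space" "x \<in> closed_chamber"
      by (auto simp: fundamental_def hyperbolic_future)
    define y where "y n = x + inverse (real (Suc n)) *\<^sub>R p" for n
    have y: "y n \<in> open_chamber" for n
      unfolding y_def using xf(3) base_open_chamber by (intro closed_open_add open_chamber_scale) auto
    have "y \<longlonglongrightarrow> x + 0 *\<^sub>R p"
      unfolding y_def by (intro tendsto_intros LIMSEQ_inverse_real_of_nat)
    then have "y \<longlonglongrightarrow> x" by simp
    then have "(\<lambda>n. normalize_time (y n)) \<longlonglongrightarrow> normalize_time x"
      using y chamber_future(2) xf(1)
      by (intro continuous_on_tendsto_compose[OF continuous_on_normalize_time]) auto
    moreover have "normalize_time x = x" using normalize_time_scale[of x 1] xf(2) by simp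
    moreover have "normalize_time (y n) \<in> open_chamber \<inter> hyperbolic_space" for n
      using chamber_normalize(1)[OF y] normalize_time_hyperbolic[OF chamber_future(2)[OF y]] by simp
    ultimately show "x \<in> closure (open_chamber \<inter> hyperbolic_space)"
      unfolding closure_sequential by metis
  qed
qed

theorem theorem3:
  fixes W :: "('n::finite minkowski \<Rightarrow>\<^sub>L 'n minkowski) set"
    and D C :: "'n minkowski set"
  assumes "discrete_reflection_group W"
    and "fundamental_domain W D"
    and "compact D"
    and "C = cone hull D"
  shows "(dual_cone C - K_minus = (\<Union>w\<in>W. (\<lambda>x. x - blinfun_apply w x) ` interior C) \<and>
          disjoint_family_on (\<lambda>w. (\<lambda>x. x - blinfun_apply w x) ` interior C) W) \<and>
         (interior K_minus = (\<Union>w\<in>W. (\<lambda>x. - x - blinfun_apply w x) ` interior C) \<and>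
          disjoint_family_on (\<lambda>w. (\<lambda>x. - x - blinfun_apply w x) ` interior C) W)"
proof -
  interpret reflection_group W by (rule reflection_group_if_discrete[OF assms(1)])
  from assms(2) obtain U where U: "U \<in> components (hyperbolic_space - \<Union>(mirrors W))" and D: "D = closure U"
    unfolding fundamental_domain_def by blast
  \<comment> \<open>Any point of the component can serve as the base point that fixes the signs of
    the roots.\<close>
  obtain p where p: "p \<in> U" using in_components_nonempty[OF U] by blast
  then have "p \<in> hyperbolic_space - \<Union>(mirrors W)" using in_components_subset[OF U] by blast
  then interpret chamber W p by unfold_locales (auto simp: mirror_complement)
  have "D = fundamental" using component_eq[OF U p] closure_open_chamber D by simp
  then interpret compact_chamber W p using assms(3) by unfold_locales simp
  have C: "C = closed_cone" using fundamental_cone_hull \<open>D = fundamental\<close> assms(4) by simp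
  show ?thesis
    unfolding C interior_closed_cone interior_K_minus
    using dual_cone_tiling dual_cone_tiling_disjoint past_cone_tiling past_cone_tiling_disjoint by blast
qed

end
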